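(* Let $W=M_uC_\varphi$ be a bounded weighted composition operator on $L^2(\mu)$, and let $J=hE(|u|^2)\circ\varphi^{-1}$. Then the following are equivalent: (i) $W$ has closed range; (ii) $W^*$ has closed range; (iii) there exists $\delta>0$ such that $J\geq\delta$ $\mu$-a.e. on $S(J)$.
   Context: $(X,\mathcal{F},\mu)$ is a $\sigma$-finite measure space, $L^2(\mu)$ is the complex $L^2$ space, $\varphi:X\to X$ is a non-singular measurable transformation (i.e. $\mu\circ\varphi^{-1}\ll\mu$), and $u:X\to[0,\infty)$ is measurable. The weighted composition operator is $Wf=M_uC_\varphi f=u\cdot(f\circ\varphi)$. Here $h=\frac{d\mu\circ\varphi^{-1}}{d\mu}$ is the Radon-Nikodym derivative and $E$ is the conditional expectation with respect to the $\sigma$-subalgebra $\varphi^{-1}(\mathcal{F})$. Since $E(f)$ has the form $g\circ\varphi$ with $g$ $\mathcal{F}$-measurable and determined a.e. on $\{h\neq0\}$, $hE(f)\circ\varphi^{-1}$ denotes the function $h\cdot g$. Thus $J=hE(|u|^2)\circ\varphi^{-1}$ is the ($\mu$-a.e. unique) nonnegative measurable function with $\int_A J\,d\mu=\int_{\varphi^{-1}(A)}|u|^2\,d\mu$ for all $A\in\mathcal{F}$. For a measurable function $f$, $S(f)=\{x\in X: f(x)\neq0\}$ is its support (defined up to $\mu$-null sets). *)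

theory Defs
  imports "HOL-Probability.Conditional_Expectation"
begin

section \<open>The complex Hilbert space of square-integrable functions\<close>

text \<open>
  The elements of \<open>L2 M\<close> are genuine almost-everywhere classes, represented as sets of
  functions. If \<open>f\<close> is not square-integrable, then \<open>L2_class M f\<close> is empty and hence not an
  element of \<open>L2 M\<close>.
\<close>

definition L2_fun :: "'a measure \<Rightarrow> ('a \<Rightarrow> complex) set" where
  "L2_fun M = {f \<in> borel_measurable M. integrable M (\<lambda>x. (cmod (f x))\<^sup>2)}"

definition L2_class :: "'a measure \<Rightarrow> ('a \<Rightarrow> complex) \<Rightarrow> ('a \<Rightarrow> complex) set" where
  "L2_class M f = {g \<in> L2_fun M. AE x in M. g x = f x}"

definition L2 :: "'a measure \<Rightarrow> ('a \<Rightarrow> complex) set set" where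
  "L2 M = L2_class M ` L2_fun M"

definition L2_rep :: "('a \<Rightarrow> complex) set \<Rightarrow> 'a \<Rightarrow> complex" where
  "L2_rep F = (SOME f. f \<in> F)"

definition L2_inner :: "'a measure \<Rightarrow> ('a \<Rightarrow> complex) set \<Rightarrow> ('a \<Rightarrow> complex) set \<Rightarrow> complex" where
  "L2_inner M F G = (\<integral>x. L2_rep F x * cnj (L2_rep G x) \<partial>M)"

definition L2_norm :: "'a measure \<Rightarrow> ('a \<Rightarrow> complex) set \<Rightarrow> real" where
  "L2_norm M F = sqrt (\<integral>x. (cmod (L2_rep F x))\<^sup>2 \<partial>M)"

definition L2_dist :: "'a measure \<Rightarrow> ('a \<Rightarrow> complex) set \<Rightarrow> ('a \<Rightarrow> complex) set \<Rightarrow> real" where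
  "L2_dist M F G = sqrt (\<integral>x. (cmod (L2_rep F x - L2_rep G x))\<^sup>2 \<partial>M)"

text \<open>
  \<open>Metric_space_L2\<close> below shows that \<open>L2_dist\<close> is a metric on \<open>L2 M\<close>, so that the topology
  used in \<open>L2_closed\<close> is the norm topology.
\<close>

definition L2_closed :: "'a measure \<Rightarrow> ('a \<Rightarrow> complex) set set \<Rightarrow> bool" where
  "L2_closed M S \<longleftrightarrow> closedin (Metric_space.mtopology (L2 M) (L2_dist M)) S"

definition L2_bounded ::
    "'a measure \<Rightarrow> (('a \<Rightarrow> complex) set \<Rightarrow> ('a \<Rightarrow> complex) set) \<Rightarrow> bool" where
  "L2_bounded M T \<longleftrightarrow>
     (\<forall>F\<in>L2 M. T F \<in> L2 M) \<and> (\<exists>C. \<forall>F\<in>L2 M. L2_norm M (T F) \<le> C * L2_norm M F)"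

definition L2_adjoint ::
    "'a measure \<Rightarrow> (('a \<Rightarrow> complex) set \<Rightarrow> ('a \<Rightarrow> complex) set) \<Rightarrow>
      ('a \<Rightarrow> complex) set \<Rightarrow> ('a \<Rightarrow> complex) set" where
  "L2_adjoint M T G =
     (THE H. H \<in> L2 M \<and> (\<forall>F\<in>L2 M. L2_inner M (T F) G = L2_inner M F H))"

definition L2_closed_range ::
    "'a measure \<Rightarrow> (('a \<Rightarrow> complex) set \<Rightarrow> ('a \<Rightarrow> complex) set) \<Rightarrow> bool" where
  "L2_closed_range M T \<longleftrightarrow> L2_closed M (T ` L2 M)"


section \<open>Weighted composition operators\<close>

definition nonsingular :: "'a measure \<Rightarrow> ('a \<Rightarrow> 'a) \<Rightarrow> bool" where
  "nonsingular M \<phi> \<longleftrightarrow> \<phi> \<in> measurable M M \<and> absolutely_continuous M (distr M M \<phi>)"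

text \<open>
  Independence of the representative holds for non-singular \<open>\<phi>\<close>; see \<open>weighted_comp_L2_class\<close>.
\<close>

definition weighted_comp ::
    "'a measure \<Rightarrow> ('a \<Rightarrow> real) \<Rightarrow> ('a \<Rightarrow> 'a) \<Rightarrow> ('a \<Rightarrow> complex) set \<Rightarrow> ('a \<Rightarrow> complex) set" where
  "weighted_comp M u \<phi> F = L2_class M (\<lambda>x. complex_of_real (u x) * L2_rep F (\<phi> x))"

text \<open>
  \<open>is_hE M \<phi> f J\<close> says that \<open>J\<close> is (a version of) \<open>h E(f) \<circ> \<phi>\<^sup>-\<^sup>1\<close> for nonnegative \<open>f\<close>, via
  the integral identity that determines this function up to null sets. By \<open>is_hE_iff\<close>, when
  the sub-\<open>\<sigma>\<close>-algebra \<open>\<phi>\<^sup>-\<^sup>1(\<F>)\<close> is \<open>\<sigma>\<close>-finite (so that the library's conditional expectation \<open>E\<close>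
  with respect to it is meaningful) this is the literal product \<open>h \<cdot> g\<close> with
  \<open>E(f) = g \<circ> \<phi>\<close>. The identity itself needs no such assumption, cf. \<open>is_hE_exists\<close>.
\<close>

definition is_hE ::
    "'a measure \<Rightarrow> ('a \<Rightarrow> 'a) \<Rightarrow> ('a \<Rightarrow> ennreal) \<Rightarrow> ('a \<Rightarrow> ennreal) \<Rightarrow> bool" where
  "is_hE M \<phi> f J \<longleftrightarrow> J \<in> borel_measurable M \<and>
     (\<forall>A\<in>sets M. (\<integral>\<^sup>+x\<in>A. J x \<partial>M) = (\<integral>\<^sup>+x\<in>\<phi> -` A \<inter> space M. f x \<partial>M))"


section \<open>Soundness of the definitions\<close>

lemma L2_class_cong:
  assumes "AE x in M. f x = g x"
  shows "L2_class M f = L2_class M g"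
proof -
  have "(AE x in M. k x = f x) \<longleftrightarrow> (AE x in M. k x = g x)" for k
    using assms by (intro eventually_subst) (auto elim: eventually_mono)
  then show ?thesis by (simp add: L2_class_def)
qed

lemma L2_rep:
  assumes "F \<in> L2 M"
  shows "L2_rep F \<in> L2_fun M" "L2_class M (L2_rep F) = F"
proof -
  obtain f where f: "f \<in> L2_fun M" "F = L2_class M f"
    using assms by (auto simp: L2_def)
  then have "f \<in> F" by (auto simp: L2_class_def)
  then have "L2_rep F \<in> F" unfolding L2_rep_def by (metis someI_ex)
  then have *: "L2_rep F \<in> L2_fun M" "AE x in M. L2_rep F x = f x"
    using f by (auto simp: L2_class_def)
  show "L2_rep F \<in> L2_fun M" by fact
  show "L2_class M (L2_rep F) = F"
    using L2_class_cong[OF *(2)] f(2) by simp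
qed

lemma L2_rep_class:
  assumes "f \<in> L2_fun M"
  shows "AE x in M. L2_rep (L2_class M f) x = f x"
proof -
  have "f \<in> L2_class M f" using assms by (auto simp: L2_class_def)
  then have "L2_rep (L2_class M f) \<in> L2_class M f" unfolding L2_rep_def by (metis someI_ex)
  then show ?thesis by (auto simp: L2_class_def)
qed

lemma weighted_comp_L2_class:
  assumes ns: "nonsingular M \<phi>" and f: "f \<in> L2_fun M"
  shows "weighted_comp M u \<phi> (L2_class M f) =
    L2_class M (\<lambda>x. complex_of_real (u x) * f (\<phi> x))"
proof -
  have [measurable]: "\<phi> \<in> measurable M M" using ns by (simp add: nonsingular_def)
  have "L2_class M f \<in> L2 M" using f by (auto simp: L2_def)
  from L2_rep(1)[OF this] have [measurable]: "L2_rep (L2_class M f) \<in> borel_measurable M"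
    by (simp add: L2_fun_def)
  have [measurable]: "f \<in> borel_measurable M" using f by (simp add: L2_fun_def)
  have "AE x in distr M M \<phi>. L2_rep (L2_class M f) x = f x"
    using ns by (intro absolutely_continuous_AE[OF _ _ L2_rep_class[OF f]]) (auto simp: nonsingular_def)
  then have "AE x in M. L2_rep (L2_class M f) (\<phi> x) = f (\<phi> x)"
    by (subst (asm) AE_distr_iff) auto
  then show ?thesis
    unfolding weighted_comp_def by (intro L2_class_cong) (auto elim: eventually_mono)
qed

lemma L2_fun_diff:
  assumes "f \<in> L2_fun M" "g \<in> L2_fun M"
  shows "(\<lambda>x. f x - g x) \<in> L2_fun M"
proof -
  have [measurable]: "f \<in> borel_measurable M" "g \<in> borel_measurable M"
    using assms by (auto simp: L2_fun_def)
  have int: "integrable M (\<lambda>x. 2 * (cmod (f x))\<^sup>2 + 2 * (cmod (g x))\<^sup>2)"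
    using assms by (auto simp: L2_fun_def)
  have "(cmod (f x - g x))\<^sup>2 \<le> 2 * (cmod (f x))\<^sup>2 + 2 * (cmod (g x))\<^sup>2" for x
  proof -
    have "(cmod (f x - g x))\<^sup>2 \<le> (cmod (f x) + cmod (g x))\<^sup>2"
      by (intro power_mono norm_triangle_ineq4) auto
    also have "\<dots> \<le> 2 * (cmod (f x))\<^sup>2 + 2 * (cmod (g x))\<^sup>2"
      using sum_squares_bound[of "cmod (f x)" "cmod (g x)"] by (simp add: power2_sum)
    finally show ?thesis .
  qed
  then have bound: "AE x in M. norm ((cmod (f x - g x))\<^sup>2) \<le> norm (2 * (cmod (f x))\<^sup>2 + 2 * (cmod (g x))\<^sup>2)"
    by (intro AE_I2) simp
  have "integrable M (\<lambda>x. (cmod (f x - g x))\<^sup>2)"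
    by (rule Bochner_Integration.integrable_bound[OF int _ bound]) measurable
  then show ?thesis by (auto simp: L2_fun_def)
qed

lemma L2_minkowski:
  assumes f: "f \<in> L2_fun M" and g: "g \<in> L2_fun M"
    and k: "k \<in> L2_fun M" and le: "\<And>x. cmod (k x) \<le> cmod (f x) + cmod (g x)"
  shows "sqrt (\<integral>x. (cmod (k x))\<^sup>2 \<partial>M) \<le>
    sqrt (\<integral>x. (cmod (f x))\<^sup>2 \<partial>M) + sqrt (\<integral>x. (cmod (g x))\<^sup>2 \<partial>M)" (is "?K \<le> ?A + ?B")
proof (rule field_le_epsilon)
  fix e :: real assume "e > 0"
  define a where "a = ?A + e / 2"
  define b where "b = ?B + e / 2"
  have nn: "?A \<ge> 0" "?B \<ge> 0" by auto
  have pos: "a > 0" "b > 0" "?A \<le> a" "?B \<le> b"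
    using \<open>e > 0\<close> nn by (auto simp: a_def b_def intro: add_nonneg_pos)
  have ptw: "(cmod (k x))\<^sup>2 \<le> (a + b) * ((cmod (f x))\<^sup>2 / a + (cmod (g x))\<^sup>2 / b)" for x
  proof -
    have "(cmod (k x))\<^sup>2 \<le> (cmod (f x) + cmod (g x))\<^sup>2"
      by (intro power_mono le) auto
    also have "\<dots> = (a + b) * ((cmod (f x))\<^sup>2 / a + (cmod (g x))\<^sup>2 / b)
        - (b * cmod (f x) - a * cmod (g x))\<^sup>2 / (a * b)"
      using pos by (simp add: field_simps power2_eq_square)
    also have "\<dots> \<le> (a + b) * ((cmod (f x))\<^sup>2 / a + (cmod (g x))\<^sup>2 / b)"
      using pos by simp
    finally show ?thesis .
  qed
  have int: "integrable M (\<lambda>x. (cmod (f x))\<^sup>2)" "integrable M (\<lambda>x. (cmod (g x))\<^sup>2)"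
    "integrable M (\<lambda>x. (cmod (k x))\<^sup>2)"
    using f g k by (auto simp: L2_fun_def)
  have sq: "(\<integral>x. (cmod (f x))\<^sup>2 \<partial>M) = ?A\<^sup>2" "(\<integral>x. (cmod (g x))\<^sup>2 \<partial>M) = ?B\<^sup>2"
    by auto
  have "(\<integral>x. (cmod (k x))\<^sup>2 \<partial>M)
      \<le> (\<integral>x. (a + b) * ((cmod (f x))\<^sup>2 / a + (cmod (g x))\<^sup>2 / b) \<partial>M)"
    using int ptw by (intro integral_mono) auto
  also have "\<dots> = (a + b) * ((\<integral>x. (cmod (f x))\<^sup>2 \<partial>M) / a + (\<integral>x. (cmod (g x))\<^sup>2 \<partial>M) / b)"
    using int by simp
  also have "\<dots> = (a + b) * (?A\<^sup>2 / a + ?B\<^sup>2 / b)"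
    using sq by simp
  also have "\<dots> \<le> (a + b) * (a + b)"
  proof -
    have "?A\<^sup>2 \<le> a\<^sup>2" "?B\<^sup>2 \<le> b\<^sup>2"
      using pos nn by (auto intro!: power_mono simp del: real_sqrt_pow2)
    then have "?A\<^sup>2 / a \<le> a" "?B\<^sup>2 / b \<le> b"
      using pos by (auto simp: divide_le_eq power2_eq_square simp del: real_sqrt_mult_self)
    then show ?thesis using pos by (intro mult_left_mono add_mono) auto
  qed
  finally have "?K \<le> a + b"
    using pos by (intro real_le_lsqrt) (auto simp: power2_eq_square)
  then show "?K \<le> ?A + ?B + e" by (simp add: a_def b_def)
qed

lemma Metric_space_L2: "Metric_space (L2 M) (L2_dist M)"
proof
  fix F G show "0 \<le> L2_dist M F G" by (simp add: L2_dist_def)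
  show "L2_dist M F G = L2_dist M G F" by (simp add: L2_dist_def norm_minus_commute)
next
  fix F G assume FG: "F \<in> L2 M" "G \<in> L2 M"
  have int: "integrable M (\<lambda>x. (cmod (L2_rep F x - L2_rep G x))\<^sup>2)"
    using L2_fun_diff[OF L2_rep(1)[OF FG(1)] L2_rep(1)[OF FG(2)]] by (simp add: L2_fun_def)
  show "L2_dist M F G = 0 \<longleftrightarrow> F = G"
  proof
    assume "L2_dist M F G = 0"
    then have "AE x in M. (cmod (L2_rep F x - L2_rep G x))\<^sup>2 = 0"
      using integral_nonneg_eq_0_iff_AE[OF int] by (simp add: L2_dist_def)
    then have "AE x in M. L2_rep F x = L2_rep G x" by simp
    then have "L2_class M (L2_rep F) = L2_class M (L2_rep G)"
      by (rule L2_class_cong)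
    then show "F = G" using FG L2_rep(2) by metis
  qed (simp add: L2_dist_def)
next
  fix F G H assume "F \<in> L2 M" "G \<in> L2 M" "H \<in> L2 M"
  then show "L2_dist M F H \<le> L2_dist M F G + L2_dist M G H"
    unfolding L2_dist_def
    using norm_triangle_ineq[of "L2_rep F x - L2_rep G x" "L2_rep G x - L2_rep H x" for x]
    by (intro L2_minkowski L2_fun_diff L2_rep(1)) simp_all
qed

lemma is_hE_density:
  assumes [measurable]: "\<phi> \<in> measurable M M" "f \<in> borel_measurable M"
  shows "is_hE M \<phi> f J \<longleftrightarrow>
    J \<in> borel_measurable M \<and> density M J = distr (density M f) M \<phi>"
proof (cases "J \<in> borel_measurable M")
  case [measurable]: True
  have "emeasure (density M J) A = (\<integral>\<^sup>+x\<in>A. J x \<partial>M)" if "A \<in> sets M" for A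
    using that by (simp add: emeasure_density)
  moreover have "emeasure (distr (density M f) M \<phi>) A = (\<integral>\<^sup>+x\<in>\<phi> -` A \<inter> space M. f x \<partial>M)"
    if [measurable]: "A \<in> sets M" for A
    by (subst emeasure_distr) (auto simp: emeasure_density)
  ultimately have "is_hE M \<phi> f J \<longleftrightarrow>
      (\<forall>A\<in>sets M. emeasure (density M J) A = emeasure (distr (density M f) M \<phi>) A)"
    by (simp add: is_hE_def)
  also have "\<dots> \<longleftrightarrow> density M J = distr (density M f) M \<phi>"
    by (auto intro: measure_eqI)
  finally show ?thesis by simp
qed (simp add: is_hE_def)

lemma is_hE_exists:
  assumes "sigma_finite_measure M" and ns: "nonsingular M \<phi>"
    and [measurable]: "f \<in> borel_measurable M"
  shows "is_hE M \<phi> f (RN_deriv M (distr (density M f) M \<phi>))"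
proof -
  interpret sigma_finite_measure M by fact
  have [measurable]: "\<phi> \<in> measurable M M" using ns by (simp add: nonsingular_def)
  have "absolutely_continuous M (distr (density M f) M \<phi>)"
    unfolding absolutely_continuous_def
  proof
    fix A assume A: "A \<in> null_sets M"
    then have [measurable]: "A \<in> sets M" by auto
    have "A \<in> null_sets (distr M M \<phi>)"
      using ns A by (auto simp: nonsingular_def absolutely_continuous_def)
    then have "\<phi> -` A \<inter> space M \<in> null_sets M" by (simp add: null_sets_distr_iff)
    then have "\<phi> -` A \<inter> space M \<in> null_sets (density M f)"
      using absolutely_continuousI_density[of f M] by (auto simp: absolutely_continuous_def)
    then show "A \<in> null_sets (distr (density M f) M \<phi>)"
      by (subst null_sets_distr_iff) auto
  qed
  then show ?thesis by (simp add: is_hE_density density_RN_deriv)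
qed

lemma is_hE_unique:
  assumes "sigma_finite_measure M" and "\<phi> \<in> measurable M M" "f \<in> borel_measurable M"
    and "is_hE M \<phi> f J" "is_hE M \<phi> f J'"
  shows "AE x in M. J x = J' x"
  using assms by (auto simp: is_hE_density intro!: sigma_finite_measure.density_unique)

lemma is_hE_iff:
  fixes M :: "'a measure" and \<phi> :: "'a \<Rightarrow> 'a"
  defines "F \<equiv> vimage_algebra (space M) \<phi> M"
    and "h \<equiv> RN_deriv M (distr M M \<phi>)"
  assumes sf: "sigma_finite_subalgebra M F" and ns: "nonsingular M \<phi>"
    and [measurable]: "f \<in> borel_measurable M"
  shows "is_hE M \<phi> f J \<longleftrightarrow> J \<in> borel_measurable M \<and>
    (\<exists>g\<in>borel_measurable M. (AE x in M. nn_cond_exp M F f x = g (\<phi> x)) \<and>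
       (AE x in M. J x = h x * g x))"
proof -
  interpret sigma_finite_subalgebra M F by fact
  have [measurable]: "\<phi> \<in> measurable M M" using ns by (simp add: nonsingular_def)
  then have \<phi>: "\<phi> \<in> space M \<rightarrow> space M" by (rule measurable_space[THEN funcsetI])
  have \<phi>F [measurable]: "\<phi> \<in> measurable F M"
    unfolding F_def by (rule measurable_vimage_algebra1[OF \<phi>])
  have setsF: "sets F = {\<phi> -` A \<inter> space M |A. A \<in> sets M}"
    unfolding F_def by (rule sets_vimage_algebra2[OF \<phi>])
  have h_meas [measurable]: "h \<in> borel_measurable M" by (simp add: h_def)
  have dh: "density M h = distr M M \<phi>"
    unfolding h_def using ns by (intro density_RN_deriv) (auto simp: nonsingular_def)
  have pull: "(\<integral>\<^sup>+x\<in>A. h x * g x \<partial>M) = (\<integral>\<^sup>+x\<in>\<phi> -` A \<inter> space M. g (\<phi> x) \<partial>M)"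
    if [measurable]: "g \<in> borel_measurable M" "A \<in> sets M" for g A
  proof -
    have "(\<integral>\<^sup>+x\<in>A. h x * g x \<partial>M) = (\<integral>\<^sup>+x. g x * indicator A x \<partial>density M h)"
      by (subst nn_integral_density) (auto simp: ac_simps)
    also have "\<dots> = (\<integral>\<^sup>+x. g (\<phi> x) * indicator A (\<phi> x) \<partial>M)"
      unfolding dh by (subst nn_integral_distr) auto
    also have "\<dots> = (\<integral>\<^sup>+x\<in>\<phi> -` A \<inter> space M. g (\<phi> x) \<partial>M)"
      by (intro nn_integral_cong) (auto simp: indicator_def)
    finally show ?thesis .
  qed
  have ce: "(\<integral>\<^sup>+x\<in>\<phi> -` A \<inter> space M. nn_cond_exp M F f x \<partial>M) =
      (\<integral>\<^sup>+x\<in>\<phi> -` A \<inter> space M. f x \<partial>M)" if "A \<in> sets M" for A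
  proof -
    have [measurable]: "\<phi> -` A \<inter> space M \<in> sets F" using that setsF by auto
    show ?thesis
      using nn_cond_exp_intg[of "indicator (\<phi> -` A \<inter> space M)" f] by (simp add: mult.commute)
  qed
  have h_fin: "AE x in M. h x \<noteq> \<infinity>"
  proof -
    obtain C where C: "countable C" "C \<subseteq> sets F" "\<Union>C = space M"
      "\<forall>c\<in>C. emeasure M c \<noteq> \<infinity>"
    proof -
      obtain C where C: "countable C" "C \<subseteq> sets F" "\<Union>C = space M"
        "\<forall>c\<in>C. emeasure (restr_to_subalg M F) c \<noteq> \<infinity>"
        using sigma_finite_measure.sigma_finite_countable[OF sigma_fin_subalg]
        unfolding sets_restr_to_subalg[OF subalg] space_restr_to_subalg by blast
      moreover have "emeasure (restr_to_subalg M F) c = emeasure M c" if "c \<in> C" for c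
        using that C(2) by (intro emeasure_restr_to_subalg[OF subalg]) blast
      ultimately show ?thesis by (intro that[of C]) auto
    qed
    then have "\<forall>c\<in>C. \<exists>A. A \<in> sets M \<and> c = \<phi> -` A \<inter> space M"
      using setsF by auto
    then obtain S where S: "\<And>c. c \<in> C \<Longrightarrow> S c \<in> sets M \<and> c = \<phi> -` S c \<inter> space M"
      by metis
    define D where "D = insert (space M - (\<Union>c\<in>C. S c)) (S ` C)"
    have U [measurable]: "(\<Union>c\<in>C. S c) \<in> sets M" using C(1) S by auto
    have "sigma_finite_measure (distr M M \<phi>)"
    proof (unfold_locales, intro exI conjI ballI)
      show "countable D" using C(1) by (simp add: D_def)
      show "D \<subseteq> sets (distr M M \<phi>)" using S U by (auto simp: D_def)
      have "(\<Union>c\<in>C. S c) \<subseteq> space M" using U by (rule sets.sets_into_space)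
      then show "\<Union>D = space (distr M M \<phi>)" by (simp add: D_def Un_absorb2)
      fix d assume "d \<in> D"
      then consider "d = space M - (\<Union>c\<in>C. S c)" | c where "c \<in> C" "d = S c"
        by (auto simp: D_def)
      then show "emeasure (distr M M \<phi>) d \<noteq> \<infinity>"
      proof cases
        case 1
        have "\<phi> -` d \<inter> space M = {}" using 1 C(3) S by blast
        then show ?thesis using 1 by (subst emeasure_distr) auto
      next
        case 2
        then have "\<phi> -` d \<inter> space M = c" "d \<in> sets M" using S by auto
        then show ?thesis using 2 C(4) by (subst emeasure_distr) auto
      qed
    qed
    then show ?thesis
      unfolding h_def using ns
      by (intro RN_deriv_finite) (auto simp: nonsingular_def)
  qed
  have prod: "is_hE M \<phi> f J"
    if [measurable]: "J \<in> borel_measurable M" "g \<in> borel_measurable M"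
      and E: "AE x in M. nn_cond_exp M F f x = g (\<phi> x)" and J: "AE x in M. J x = h x * g x" for J g
    unfolding is_hE_def
  proof (intro conjI ballI)
    fix A assume A [measurable]: "A \<in> sets M"
    have "(\<integral>\<^sup>+x\<in>A. J x \<partial>M) = (\<integral>\<^sup>+x\<in>A. h x * g x \<partial>M)"
      using J by (intro nn_integral_cong_AE) auto
    also have "\<dots> = (\<integral>\<^sup>+x\<in>\<phi> -` A \<inter> space M. g (\<phi> x) \<partial>M)" by (rule pull) auto
    also have "\<dots> = (\<integral>\<^sup>+x\<in>\<phi> -` A \<inter> space M. nn_cond_exp M F f x \<partial>M)"
      using E by (intro nn_integral_cong_AE) auto
    also have "\<dots> = (\<integral>\<^sup>+x\<in>\<phi> -` A \<inter> space M. f x \<partial>M)" by (rule ce) fact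
    finally show "(\<integral>\<^sup>+x\<in>A. J x \<partial>M) = (\<integral>\<^sup>+x\<in>\<phi> -` A \<inter> space M. f x \<partial>M)" .
  qed fact
  show ?thesis
  proof
    assume hE: "is_hE M \<phi> f J"
    then have J [measurable]: "J \<in> borel_measurable M" by (simp add: is_hE_def)
    define g where "g x = J x / h x" for x
    have g [measurable]: "g \<in> borel_measurable M" unfolding g_def by measurable
    have Z [measurable]: "{x \<in> space M. h x = 0} \<in> sets M" by measurable
    have "(\<integral>\<^sup>+x\<in>{x \<in> space M. h x = 0}. J x \<partial>M) =
        (\<integral>\<^sup>+x\<in>\<phi> -` {x \<in> space M. h x = 0} \<inter> space M. f x \<partial>M)"
      using hE Z by (simp add: is_hE_def)
    also have "\<dots> = 0"
    proof -
      have "emeasure M (\<phi> -` {x \<in> space M. h x = 0} \<inter> space M) =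
          emeasure (density M h) {x \<in> space M. h x = 0}"
        unfolding dh by (subst emeasure_distr) auto
      also have "\<dots> = (\<integral>\<^sup>+x. h x * indicator {x \<in> space M. h x = 0} x \<partial>M)"
        by (simp add: emeasure_density)
      also have "\<dots> = (\<integral>\<^sup>+x. 0 \<partial>M)"
        by (intro nn_integral_cong) (auto split: split_indicator)
      finally have "\<phi> -` {x \<in> space M. h x = 0} \<inter> space M \<in> null_sets M"
        by (intro null_setsI) auto
      then show ?thesis by (rule nn_integral_null_set)
    qed
    finally have "AE x in M. J x * indicator {x \<in> space M. h x = 0} x = 0"
      by (subst (asm) nn_integral_0_iff_AE) auto
    with h_fin have Jg: "AE x in M. J x = h x * g x"
      using AE_space
    proof eventually_elim
      case (elim x)
      show ?case
      proof (cases "h x = 0")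
        case True
        with elim show ?thesis by simp
      next
        case False
        with elim have "J x * h x / h x = J x" by (intro mult_divide_eq_ennreal) auto
        then show ?thesis by (simp add: g_def ennreal_times_divide mult.commute[of "h x"])
      qed
    qed
    have "AE x in M. g (\<phi> x) = nn_cond_exp M F f x"
    proof (rule nn_cond_exp_charact)
      fix B assume "B \<in> sets F"
      then obtain A where A: "A \<in> sets M" "B = \<phi> -` A \<inter> space M" using setsF by auto
      have "(\<integral>\<^sup>+x\<in>B. f x \<partial>M) = (\<integral>\<^sup>+x\<in>A. J x \<partial>M)"
        using hE A by (simp add: is_hE_def)
      also have "\<dots> = (\<integral>\<^sup>+x\<in>A. h x * g x \<partial>M)"
        using Jg by (intro nn_integral_cong_AE) auto
      also have "\<dots> = (\<integral>\<^sup>+x\<in>B. g (\<phi> x) \<partial>M)" unfolding A(2) by (rule pull) (use A in auto)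
      finally show "(\<integral>\<^sup>+x\<in>B. f x \<partial>M) = (\<integral>\<^sup>+x\<in>B. g (\<phi> x) \<partial>M)" .
    qed auto
    then have "AE x in M. nn_cond_exp M F f x = g (\<phi> x)"
      by (rule eventually_mono) simp
    then show "J \<in> borel_measurable M \<and>
      (\<exists>g\<in>borel_measurable M. (AE x in M. nn_cond_exp M F f x = g (\<phi> x)) \<and>
         (AE x in M. J x = h x * g x))"
      using J g Jg by blast
  qed (use prod in blast)
qed

end

theory Submission
  imports Defs
begin

text \<open>
  Write \<open>W\<close> for the operator and \<open>S\<close> for the support of \<open>J\<close>. The measure \<open>J d\<mu>\<close> is the image of
  \<open>u\<^sup>2 d\<mu>\<close> under \<open>\<phi>\<close>, so \<open>\<langle>W f, W g\<rangle> = \<integral> J f g\<^sup>* d\<mu>\<close>: the operator \<open>W\<^sup>*W\<close> is multiplication by \<open>J\<close>, and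
  \<open>W\<close> is isometric for the norm with square \<open>\<integral> J |f|\<^sup>2 d\<mu>\<close>. Boundedness makes \<open>J\<close> finite almost everywhere.

  Each range is compared with the condition
  (C) that \<open>H / J\<close> is integrable for every integrable \<open>H \<ge> 0\<close> vanishing off \<open>S\<close>.
  By \<open>bounded_below_on_support\<close>, (C) forces \<open>J \<ge> \<delta> > 0\<close> on \<open>S\<close>.

  If \<open>W\<close> has closed range, then \<open>u \<cdot> (f \<circ> \<phi>)\<close> with \<open>f = sqrt (H / J)\<close> is a limit of points of the
  range, hence equals \<open>W f'\<close> with \<open>f'\<close> square-integrable, and \<open>f = f'\<close> on \<open>S\<close>; this is (C). If \<open>W\<^sup>*\<close> has
  closed range, then \<open>sqrt H\<close> is a limit of points \<open>W\<^sup>*W f\<^sub>n\<close>, hence equals \<open>W\<^sup>* k\<close> for some \<open>k\<close>, and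
  \<open>\<integral> H / J d\<mu> \<le> \<parallel>k\<parallel>\<^sup>2\<close>; this is (C) again.

  Conversely, let \<open>J \<ge> \<delta>\<close> on \<open>S\<close>. Every value of \<open>W\<^sup>*\<close> vanishes off \<open>S\<close>, and every square-integrable \<open>g\<close>
  vanishing off \<open>S\<close> is \<open>W\<^sup>*W (g / J)\<close>; so the range of \<open>W\<^sup>*\<close> is the closed space of all such \<open>g\<close>. For \<open>g\<close>
  in the closure of the range of \<open>W\<close>, the vector \<open>g - W ((W\<^sup>* g) / J)\<close> is orthogonal to that range and lies
  in its closure, so it is zero.

  The adjoint is constructed from Radon-Nikodym densities: for \<open>k \<ge> 0\<close> it is the density of the image
  of \<open>u k d\<mu>\<close> under \<open>\<phi>\<close> (\<open>is_adj_exists_nonneg\<close>), and the general case follows by linearity.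
\<close>

section \<open>Square-integrable functions\<close>

lemma L2_fun_integrable: "f \<in> L2_fun M \<Longrightarrow> integrable M (\<lambda>x. (cmod (f x))\<^sup>2)"
  by (simp add: L2_fun_def)

lemma L2_fun_measurable: "f \<in> L2_fun M \<Longrightarrow> f \<in> borel_measurable M"
  by (simp add: L2_fun_def)

lemma L2_fun_bound:
  assumes "f \<in> borel_measurable M" "integrable M G" "AE x in M. (cmod (f x))\<^sup>2 \<le> G x"
  shows "f \<in> L2_fun M"
proof -
  have [measurable]: "f \<in> borel_measurable M" by fact
  have "AE x in M. norm ((cmod (f x))\<^sup>2) \<le> norm (G x)"
    using assms(3) by eventually_elim auto
  then have "integrable M (\<lambda>x. (cmod (f x))\<^sup>2)"
    by (intro Bochner_Integration.integrable_bound[OF assms(2)]) measurable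
  then show ?thesis by (simp add: L2_fun_def)
qed

lemma L2_fun_cong_AE:
  assumes "f \<in> L2_fun M" "g \<in> borel_measurable M" "AE x in M. g x = f x"
  shows "g \<in> L2_fun M"
  using assms(3) by (intro L2_fun_bound[OF assms(2) L2_fun_integrable[OF assms(1)]]) auto

lemma L2_fun_scale:
  assumes "f \<in> L2_fun M"
  shows "(\<lambda>x. c * f x) \<in> L2_fun M"
  using assms by (auto simp: L2_fun_def norm_mult power_mult_distrib)

lemma L2_fun_add:
  assumes "f \<in> L2_fun M" "g \<in> L2_fun M"
  shows "(\<lambda>x. f x + g x) \<in> L2_fun M"
  using L2_fun_diff[OF assms(1) L2_fun_scale[OF assms(2), of "-1"]] by simp

lemma borel_measurable_cnj [measurable (raw)]:
  "f \<in> borel_measurable M \<Longrightarrow> (\<lambda>x. cnj (f x)) \<in> borel_measurable M"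
  by (rule borel_measurable_continuous_on[OF continuous_on_cnj[OF continuous_on_id]])

lemma integrable_L2_inner:
  assumes "f \<in> L2_fun M" "g \<in> L2_fun M"
  shows "integrable M (\<lambda>x. f x * cnj (g x))"
proof -
  have [measurable]: "f \<in> borel_measurable M" "g \<in> borel_measurable M"
    using assms by (auto simp: L2_fun_def)
  have "integrable M (\<lambda>x. (cmod (f x))\<^sup>2 + (cmod (g x))\<^sup>2)"
    using assms by (auto simp: L2_fun_def)
  moreover have "norm (f x * cnj (g x)) \<le> norm ((cmod (f x))\<^sup>2 + (cmod (g x))\<^sup>2)" for x
  proof -
    have "0 \<le> cmod (f x) * cmod (g x)" by simp
    then have "cmod (f x) * cmod (g x) \<le> (cmod (f x))\<^sup>2 + (cmod (g x))\<^sup>2"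
      using sum_squares_bound[of "cmod (f x)" "cmod (g x)"] by linarith
    also have "\<dots> \<le> norm ((cmod (f x))\<^sup>2 + (cmod (g x))\<^sup>2)" by (simp only: real_norm_def abs_ge_self)
    finally show ?thesis by (simp only: norm_mult complex_mod_cnj)
  qed
  ultimately show ?thesis
    by (intro Bochner_Integration.integrable_bound[where g = "\<lambda>x. f x * cnj (g x)", OF _ _ AE_I2])
      measurable
qed

text \<open>The arithmetic-geometric mean form of the Cauchy-Schwarz inequality.\<close>

lemma L2_inner_AM_GM:
  assumes "f \<in> L2_fun M" "g \<in> L2_fun M"
  shows "2 * Re (\<integral>x. f x * cnj (g x) \<partial>M) \<le> (\<integral>x. (cmod (f x))\<^sup>2 \<partial>M) + (\<integral>x. (cmod (g x))\<^sup>2 \<partial>M)"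
proof -
  note int = integrable_L2_inner[OF assms]
  have "2 * Re (f x * cnj (g x)) \<le> (cmod (f x))\<^sup>2 + (cmod (g x))\<^sup>2" for x
    using complex_Re_le_cmod[of "f x * cnj (g x)"] sum_squares_bound[of "cmod (f x)" "cmod (g x)"]
    by (simp add: norm_mult)
  then have "(\<integral>x. 2 * Re (f x * cnj (g x)) \<partial>M) \<le> (\<integral>x. (cmod (f x))\<^sup>2 + (cmod (g x))\<^sup>2 \<partial>M)"
    by (intro integral_mono integrable_mult_right integrable_Re int Bochner_Integration.integrable_add
        L2_fun_integrable assms)
  moreover have "(\<integral>x. 2 * Re (f x * cnj (g x)) \<partial>M) = 2 * Re (\<integral>x. f x * cnj (g x) \<partial>M)"
    by (simp only: integral_mult_right_zero integral_Re[OF int])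
  moreover have "(\<integral>x. (cmod (f x))\<^sup>2 + (cmod (g x))\<^sup>2 \<partial>M) =
      (\<integral>x. (cmod (f x))\<^sup>2 \<partial>M) + (\<integral>x. (cmod (g x))\<^sup>2 \<partial>M)"
    by (intro Bochner_Integration.integral_add L2_fun_integrable assms)
  ultimately show ?thesis by linarith
qed

lemma L2_fun_eq_0_AE:
  assumes "f \<in> L2_fun M" "(\<integral>x. (cmod (f x))\<^sup>2 \<partial>M) \<le> 0"
  shows "AE x in M. f x = 0"
proof -
  have "(\<integral>x. (cmod (f x))\<^sup>2 \<partial>M) = 0"
    using assms(2) by (intro antisym Bochner_Integration.integral_nonneg) auto
  then show ?thesis
    using integral_nonneg_eq_0_iff_AE[OF L2_fun_integrable[OF assms(1)]] by auto
qed

lemma L2_fun_eq_AE_of_inner: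
  assumes "H \<in> L2_fun M" "H' \<in> L2_fun M"
    and eq: "\<And>f. f \<in> L2_fun M \<Longrightarrow> (\<integral>x. f x * cnj (H x) \<partial>M) = (\<integral>x. f x * cnj (H' x) \<partial>M)"
  shows "AE x in M. H x = H' x"
proof -
  note d = L2_fun_diff[OF assms(1,2)]
  have "complex_of_real (\<integral>x. (cmod (H x - H' x))\<^sup>2 \<partial>M) = (\<integral>x. (H x - H' x) * cnj (H x - H' x) \<partial>M)"
    by (simp only: integral_complex_of_real[symmetric] complex_norm_square)
  also have "\<dots> = (\<integral>x. (H x - H' x) * cnj (H x) - (H x - H' x) * cnj (H' x) \<partial>M)"
    by (simp add: right_diff_distrib)
  also have "\<dots> = 0"
    using eq[OF d] integrable_L2_inner[OF d assms(1)] integrable_L2_inner[OF d assms(2)]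
    by (subst Bochner_Integration.integral_diff) auto
  finally have "AE x in M. H x - H' x = 0"
    by (intro L2_fun_eq_0_AE[OF d]) simp
  then show ?thesis by simp
qed

text \<open>Fatou's lemma for a truncation that is eventually exact at every point.\<close>

lemma integrable_of_bounded_truncations:
  fixes f :: "'a \<Rightarrow> real" and g :: "nat \<Rightarrow> 'a \<Rightarrow> real"
  assumes f: "f \<in> borel_measurable M" "AE x in M. 0 \<le> f x"
    and g: "\<And>n. integrable M (g n)" "\<And>n. (\<integral>x. g n x \<partial>M) \<le> B" "\<And>n. AE x in M. 0 \<le> g n x"
    and ev: "AE x in M. eventually (\<lambda>n. g n x = f x) sequentially"
  shows "integrable M f"
proof -
  have [measurable]: "f \<in> borel_measurable M" "g n \<in> borel_measurable M" for n
    using f g by auto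
  have "(\<integral>\<^sup>+x. ennreal (f x) \<partial>M) = (\<integral>\<^sup>+x. liminf (\<lambda>n. ennreal (g n x)) \<partial>M)"
  proof (rule nn_integral_cong_AE, use ev in eventually_elim)
    case (elim x)
    then have "eventually (\<lambda>n. ennreal (g n x) = ennreal (f x)) sequentially"
      by eventually_elim simp
    then have "(\<lambda>n. ennreal (g n x)) \<longlonglongrightarrow> ennreal (f x)"
      by (rule tendsto_eventually)
    then show ?case by (simp add: lim_imp_Liminf)
  qed
  also have "\<dots> \<le> liminf (\<lambda>n. \<integral>\<^sup>+x. ennreal (g n x) \<partial>M)"
    by (rule nn_integral_liminf) simp
  also have "\<dots> \<le> ennreal B"
  proof (rule Liminf_le)
    show "\<forall>\<^sub>F n in sequentially. (\<integral>\<^sup>+x. ennreal (g n x) \<partial>M) \<le> ennreal B"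
      using g by (intro always_eventually allI) (simp add: nn_integral_eq_integral ennreal_leI)
  qed simp
  also have "\<dots> < \<infinity>" by simp
  finally show ?thesis
    using f by (intro integrableI_nonneg) auto
qed

lemma integral_truncation_tendsto_0:
  fixes H j :: "'a \<Rightarrow> real"
  assumes [measurable]: "j \<in> borel_measurable M" and H: "integrable M H"
    and "\<And>x. 0 \<le> j x" "\<And>x. j x = 0 \<Longrightarrow> H x = 0"
  shows "(\<lambda>n. \<integral>x. indicator {x. j x < 1 / real (Suc n)} x * H x \<partial>M) \<longlonglongrightarrow> 0"
proof -
  have [measurable]: "H \<in> borel_measurable M" using H by auto
  have "(\<lambda>n. \<integral>x. indicator {x. j x < 1 / real (Suc n)} x * H x \<partial>M) \<longlonglongrightarrow> (\<integral>x. 0 \<partial>M)"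
  proof (rule integral_dominated_convergence[where w = "\<lambda>x. norm (H x)"])
    show "AE x in M. (\<lambda>n. indicator {x. j x < 1 / real (Suc n)} x * H x) \<longlonglongrightarrow> 0"
    proof (rule AE_I2)
      fix x
      show "(\<lambda>n. indicator {x. j x < 1 / real (Suc n)} x * H x) \<longlonglongrightarrow> 0"
      proof (cases "j x = 0")
        case False
        with assms(3)[of x] have "j x > 0" by simp
        moreover have "(\<lambda>n. 1 / real (Suc n)) \<longlonglongrightarrow> 0" by real_asymp
        ultimately have "\<forall>\<^sub>F n in sequentially. 1 / real (Suc n) < j x"
          by (rule order_tendstoD(2)[rotated])
        then have "\<forall>\<^sub>F n in sequentially. indicator {x. j x < 1 / real (Suc n)} x * H x = 0"
          by eventually_elim (auto simp: indicator_def)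
        then show ?thesis by (rule tendsto_eventually)
      qed (use assms(4) in auto)
    qed
    show "\<And>n. AE x in M. norm (indicator {x. j x < 1 / real (Suc n)} x * H x) \<le> norm (H x)"
      by (auto simp: indicator_def)
  qed (use H in auto)
  then show ?thesis by simp
qed

section \<open>A measure-theoretic criterion for lower bounds\<close>

text \<open>
  If dividing by \<open>j\<close> preserves integrability of the nonnegative functions supported where \<open>j\<close>
  does not vanish, then \<open>j\<close> is bounded away from zero there. Otherwise the sets \<open>{0 < j < 4\<^sup>-\<^sup>n}\<close> all have
  positive measure, and a function \<open>H\<close> with mass at least \<open>2\<^sup>-\<^sup>n\<close> on each of them gives \<open>H / j\<close> an
  integral of at least \<open>2\<^sup>n\<close> for every \<open>n\<close>.
\<close>

lemma (in sigma_finite_measure) bounded_below_on_support: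
  fixes j :: "'a \<Rightarrow> real"
  assumes [measurable]: "j \<in> borel_measurable M" and nn: "\<And>x. 0 \<le> j x"
    and ints: "\<And>H. integrable M H \<Longrightarrow> (\<And>x. 0 \<le> H x) \<Longrightarrow> (\<And>x. j x = 0 \<Longrightarrow> H x = 0) \<Longrightarrow>
      integrable M (\<lambda>x. H x / j x)"
  shows "\<exists>\<delta>>0. AE x in M. j x \<noteq> 0 \<longrightarrow> \<delta> \<le> j x"
proof (rule ccontr)
  assume neg: "\<not> ?thesis"
  obtain p where p [measurable]: "p \<in> borel_measurable M" and
    pfin: "integral\<^sup>N M p \<noteq> \<infinity>" and ppos: "\<And>x. x \<in> space M \<Longrightarrow> 0 < p x \<and> p x < \<infinity>"
    using Ex_finite_integrable_function by blast
  define B where "B n = {x \<in> space M. j x \<noteq> 0 \<and> j x < (1/4)^n}" for n :: nat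
  have [measurable]: "B n \<in> sets M" for n unfolding B_def by measurable
  \<comment> \<open>The sets \<open>B n\<close> may have infinite measure; the weight \<open>p\<close> makes their mass finite.\<close>
  define a where "a n = (\<integral>\<^sup>+x. p x * indicator (B n) x \<partial>M)" for n
  have a_fin: "a n < top" for n
  proof -
    have "a n \<le> integral\<^sup>N M p"
      unfolding a_def by (intro nn_integral_mono) (auto simp: indicator_def)
    then show ?thesis using pfin by (auto simp: less_top[symmetric] top_unique)
  qed
  have a_pos: "a n \<noteq> 0" for n
  proof
    assume "a n = 0"
    then have "AE x in M. p x * indicator (B n) x = 0"
      unfolding a_def by (subst (asm) nn_integral_0_iff_AE) auto
    then have "AE x in M. j x \<noteq> 0 \<longrightarrow> (1/4)^n \<le> j x"
      using AE_space by eventually_elim (auto simp: B_def indicator_def dest: ppos split: if_splits)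
    then show False using neg by (auto dest!: spec[of _ "(1/4)^n"])
  qed
  define G where "G x = (\<Sum>n. ennreal ((1/2)^n) * (p x * indicator (B n) x / a n))" for x
  have [measurable]: "G \<in> borel_measurable M" unfolding G_def by measurable
  have norm1: "(\<integral>\<^sup>+x. c * (p x * indicator (B n) x / a n) \<partial>M) = c" for n c
  proof -
    have "(\<integral>\<^sup>+x. c * (p x * indicator (B n) x / a n) \<partial>M) = c * (a n / a n)"
      unfolding a_def by (subst nn_integral_cmult, simp, subst nn_integral_divide) auto
    then show ?thesis using a_fin[of n] a_pos[of n] by simp
  qed
  have "(\<integral>\<^sup>+x. G x \<partial>M) = (\<Sum>n. \<integral>\<^sup>+x. ennreal ((1/2)^n) * (p x * indicator (B n) x / a n) \<partial>M)"
    unfolding G_def by (rule nn_integral_suminf) measurable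
  also have "\<dots> = (\<Sum>n. ennreal ((1/2)^n))" by (simp add: norm1)
  also have "\<dots> < top"
    by (subst suminf_ennreal2) (auto intro!: summable_geometric)
  finally have G_int: "(\<integral>\<^sup>+x. G x \<partial>M) < top" .
  then have G_fin: "AE x in M. G x < top"
    using nn_integral_PInf_AE[of G M] by (auto simp: less_top)
  \<comment> \<open>Where \<open>G\<close> is finite, the indicator changes nothing; \<open>ints\<close> asks for zeros at every point.\<close>
  define H where "H x = enn2real (G x) * indicator {x. j x \<noteq> 0} x" for x
  have HG: "AE x in M. ennreal (H x) = G x"
    using G_fin AE_space
  proof eventually_elim
    case (elim x)
    have "G x = 0" if "j x = 0" using that by (simp add: G_def B_def)
    then show ?case using elim by (auto simp: H_def indicator_def)
  qed
  have [measurable]: "H \<in> borel_measurable M" unfolding H_def by measurable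
  have "integrable M H"
  proof (rule integrableI_nonneg)
    show "(\<integral>\<^sup>+x. ennreal (H x) \<partial>M) < \<infinity>"
      using G_int HG by (subst nn_integral_cong_AE[OF HG]) auto
  qed (auto simp: H_def)
  then have "integrable M (\<lambda>x. H x / j x)"
    by (rule ints) (auto simp: H_def)
  then have fin: "(\<integral>\<^sup>+x. ennreal (H x / j x) \<partial>M) < top"
    using nn by (subst nn_integral_eq_integral) (auto simp: H_def)
  have big: "ennreal (2^n) \<le> (\<integral>\<^sup>+x. ennreal (H x / j x) \<partial>M)" for n :: nat
  proof -
    have "ennreal (2^n) = (\<integral>\<^sup>+x. ennreal (2^n) * (p x * indicator (B n) x / a n) \<partial>M)"
      by (simp add: norm1)
    also have "\<dots> \<le> (\<integral>\<^sup>+x. ennreal (H x / j x) \<partial>M)"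
    proof (rule nn_integral_mono_AE, use HG in eventually_elim)
      case (elim x)
      show ?case
      proof (cases "x \<in> B n")
        case True
        then have j: "0 < j x" "j x < (1/4)^n" using nn[of x] by (auto simp: B_def)
        have "ennreal ((1/2)^n) * (p x * indicator (B n) x / a n) \<le> G x"
          unfolding G_def
          using sum_le_suminf[of "\<lambda>n. ennreal ((1/2)^n) * (p x * indicator (B n) x / a n)" "{n}"]
          by (simp add: summableI)
        then have "ennreal ((1/2)^n) * (p x * indicator (B n) x / a n) \<le> ennreal (H x)"
          using elim by simp
        then have "ennreal (4^n) * (ennreal ((1/2)^n) * (p x * indicator (B n) x / a n)) 
          \<le> ennreal (4^n) * ennreal (H x)" by (rule mult_left_mono) simp
        also have "ennreal (4^n) * ennreal (H x) = ennreal (4^n * H x)"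
          by (simp add: ennreal_mult' flip: ennreal_power)
        also have "\<dots> \<le> ennreal (H x / j x)"
        proof (rule ennreal_leI)
          have "4^n * j x \<le> 1" using j by (simp add: power_one_over field_simps)
          then have "H x * (4^n * j x) \<le> H x * 1" by (intro mult_left_mono) (auto simp: H_def)
          then show "4^n * H x \<le> H x / j x" using j by (simp add: field_simps)
        qed
        also have "ennreal (4^n) * (ennreal ((1/2)^n) * (p x * indicator (B n) x / a n)) =
            ennreal (2^n) * (p x * indicator (B n) x / a n)"
          by (simp add: mult.assoc[symmetric] ennreal_mult''[symmetric] power_mult_distrib[symmetric])
        finally show ?thesis .
      qed simp
    qed
    finally show ?thesis .
  qed
  obtain r where r: "(\<integral>\<^sup>+x. ennreal (H x / j x) \<partial>M) = ennreal r" "r \<ge> 0"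
    using fin by (cases "(\<integral>\<^sup>+x. ennreal (H x / j x) \<partial>M)") auto
  obtain n where "r < 2^n" using real_arch_pow[of 2 r] by auto
  then show False using big[of n] r by simp
qed

section \<open>Almost-everywhere classes and the norm topology\<close>

lemma L2_class_in_L2: "f \<in> L2_fun M \<Longrightarrow> L2_class M f \<in> L2 M"
  by (simp add: L2_def)

lemma ball_L2: "(\<forall>F\<in>L2 M. P F) \<longleftrightarrow> (\<forall>f\<in>L2_fun M. P (L2_class M f))"
  by (simp add: L2_def)

lemma L2_class_eqD:
  assumes "f \<in> L2_fun M" "L2_class M f = L2_class M g"
  shows "AE x in M. f x = g x"
proof -
  have "f \<in> L2_class M g" using assms by (auto simp: L2_class_def)
  then show ?thesis by (simp add: L2_class_def)
qed

lemma L2_class_in_L2D: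
  assumes "f \<in> borel_measurable M" "L2_class M f \<in> L2 M"
  shows "f \<in> L2_fun M"
proof -
  obtain g where g: "g \<in> L2_fun M" "L2_class M g = L2_class M f"
    using assms(2) by (auto simp: L2_def)
  have "AE x in M. f x = g x"
    using L2_class_eqD[OF g] by eventually_elim simp
  then show ?thesis by (rule L2_fun_cong_AE[OF g(1) assms(1)])
qed

lemma L2_rep_class_measurable:
  "f \<in> L2_fun M \<Longrightarrow> L2_rep (L2_class M f) \<in> borel_measurable M"
  by (intro L2_fun_measurable L2_rep(1) L2_class_in_L2)

lemma L2_norm_class:
  assumes "f \<in> L2_fun M"
  shows "L2_norm M (L2_class M f) = sqrt (\<integral>x. (cmod (f x))\<^sup>2 \<partial>M)"
proof -
  note [measurable] = L2_rep_class_measurable[OF assms] L2_fun_measurable[OF assms]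
  have "AE x in M. (cmod (L2_rep (L2_class M f) x))\<^sup>2 = (cmod (f x))\<^sup>2"
    using L2_rep_class[OF assms] by eventually_elim simp
  then show ?thesis
    unfolding L2_norm_def by (intro arg_cong[where f = sqrt] integral_cong_AE) auto
qed

lemma L2_dist_class:
  assumes "f \<in> L2_fun M" "g \<in> L2_fun M"
  shows "L2_dist M (L2_class M f) (L2_class M g) = sqrt (\<integral>x. (cmod (f x - g x))\<^sup>2 \<partial>M)"
proof -
  note [measurable] = L2_rep_class_measurable[OF assms(1)] L2_fun_measurable[OF assms(1)]
    L2_rep_class_measurable[OF assms(2)] L2_fun_measurable[OF assms(2)]
  have "AE x in M. (cmod (L2_rep (L2_class M f) x - L2_rep (L2_class M g) x))\<^sup>2 = (cmod (f x - g x))\<^sup>2"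
    using L2_rep_class[OF assms(1)] L2_rep_class[OF assms(2)] by eventually_elim simp
  then show ?thesis
    unfolding L2_dist_def by (intro arg_cong[where f = sqrt] integral_cong_AE) auto
qed

lemma L2_inner_class:
  assumes "f \<in> L2_fun M" "g \<in> L2_fun M"
  shows "L2_inner M (L2_class M f) (L2_class M g) = (\<integral>x. f x * cnj (g x) \<partial>M)"
proof -
  note [measurable] = L2_rep_class_measurable[OF assms(1)] L2_fun_measurable[OF assms(1)]
    L2_rep_class_measurable[OF assms(2)] L2_fun_measurable[OF assms(2)]
  have "AE x in M. L2_rep (L2_class M f) x * cnj (L2_rep (L2_class M g) x) = f x * cnj (g x)"
    using L2_rep_class[OF assms(1)] L2_rep_class[OF assms(2)] by eventually_elim simp
  then show ?thesis
    unfolding L2_inner_def by (intro integral_cong_AE) auto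
qed

text \<open>Closedness in the norm topology, by approximation with square-integrable functions.\<close>

lemma L2_closed_iff:
  assumes "S \<subseteq> L2 M"
  shows "L2_closed M S \<longleftrightarrow> (\<forall>g\<in>L2_fun M.
    (\<forall>\<epsilon>>0. \<exists>f\<in>L2_fun M. L2_class M f \<in> S \<and> (\<integral>x. (cmod (f x - g x))\<^sup>2 \<partial>M) < \<epsilon>) \<longrightarrow>
    L2_class M g \<in> S)"
    (is "_ \<longleftrightarrow> (\<forall>g\<in>_. ?near g \<longrightarrow> _)")
proof -
  interpret Metric_space "L2 M" "L2_dist M" by (rule Metric_space_L2)
  have near: "?near g \<longleftrightarrow> (\<forall>r>0. \<not> disjnt S (mball (L2_class M g) r))" if g: "g \<in> L2_fun M" for g
  proof
    assume n: "?near g"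
    show "\<forall>r>0. \<not> disjnt S (mball (L2_class M g) r)"
    proof (intro allI impI)
      fix r :: real assume "r > 0"
      then obtain f where f: "f \<in> L2_fun M" "L2_class M f \<in> S"
        "(\<integral>x. (cmod (f x - g x))\<^sup>2 \<partial>M) < r\<^sup>2"
        using n by (meson zero_less_power)
      then have "sqrt (\<integral>x. (cmod (f x - g x))\<^sup>2 \<partial>M) < r"
        using \<open>r > 0\<close> by (intro real_less_lsqrt) auto
      then have "L2_class M f \<in> mball (L2_class M g) r"
        using f g by (simp add: L2_class_in_L2 commute L2_dist_class)
      then show "\<not> disjnt S (mball (L2_class M g) r)" using f by (auto simp: disjnt_def)
    qed
  next
    assume n: "\<forall>r>0. \<not> disjnt S (mball (L2_class M g) r)"
    show "?near g"
    proof (intro allI impI)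
      fix \<epsilon> :: real assume "\<epsilon> > 0"
      then have "\<not> disjnt S (mball (L2_class M g) (sqrt \<epsilon>))" using n by simp
      then obtain F where F: "F \<in> S" "F \<in> L2 M" "L2_dist M (L2_class M g) F < sqrt \<epsilon>"
        by (auto simp: disjnt_def)
      then have "L2_class M (L2_rep F) \<in> S"
        "(\<integral>x. (cmod (L2_rep F x - g x))\<^sup>2 \<partial>M) < \<epsilon>"
        using L2_dist_class[OF L2_rep(1)[OF F(2)] g] L2_rep(2)[OF F(2)] by (simp_all add: commute)
      then show "\<exists>f\<in>L2_fun M. L2_class M f \<in> S \<and> (\<integral>x. (cmod (f x - g x))\<^sup>2 \<partial>M) < \<epsilon>"
        using L2_rep(1)[OF F(2)] by blast
    qed
  qed
  have "L2_closed M S \<longleftrightarrow> (\<forall>G\<in>L2 M. (\<forall>r>0. \<not> disjnt S (mball G r)) \<longrightarrow> G \<in> S)"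
    unfolding L2_closed_def closedin_metric using assms by blast
  also have "\<dots> \<longleftrightarrow> (\<forall>g\<in>L2_fun M. ?near g \<longrightarrow> L2_class M g \<in> S)"
    unfolding ball_L2 using near by simp
  finally show ?thesis .
qed

section \<open>Weighted composition operators on functions\<close>

text \<open>
  The change of variables behind the adjoint: if \<open>j d\<mu>\<close> is the image of \<open>w d\<mu>\<close> under \<open>\<phi>\<close>, then
  functions \<open>f \<circ> \<phi>\<close> with weight \<open>w\<close> integrate as \<open>f\<close> with weight \<open>j\<close>.
\<close>

lemma
  fixes f :: "'a \<Rightarrow> 'b::{banach, second_countable_topology}" and j w :: "'a \<Rightarrow> real"
  assumes [measurable]: "\<phi> \<in> measurable M M" "w \<in> borel_measurable M" "j \<in> borel_measurable M"
      "f \<in> borel_measurable M"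
    and nn: "AE x in M. 0 \<le> w x" "AE x in M. 0 \<le> j x"
    and dens: "density M (\<lambda>x. ennreal (j x)) = distr (density M (\<lambda>x. ennreal (w x))) M \<phi>"
  shows integral_pushforward: "(\<integral>x. j x *\<^sub>R f x \<partial>M) = (\<integral>x. w x *\<^sub>R f (\<phi> x) \<partial>M)"
    and integrable_pushforward:
      "integrable M (\<lambda>x. j x *\<^sub>R f x) \<longleftrightarrow> integrable M (\<lambda>x. w x *\<^sub>R f (\<phi> x))"
proof -
  have "(\<integral>x. j x *\<^sub>R f x \<partial>M) = integral\<^sup>L (density M (\<lambda>x. ennreal (j x))) f"
    using nn by (subst integral_density) auto
  also have "\<dots> = integral\<^sup>L (density M (\<lambda>x. ennreal (w x))) (\<lambda>x. f (\<phi> x))"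
    unfolding dens by (subst integral_distr) auto
  also have "\<dots> = (\<integral>x. w x *\<^sub>R f (\<phi> x) \<partial>M)"
    using nn by (subst integral_density) auto
  finally show "(\<integral>x. j x *\<^sub>R f x \<partial>M) = (\<integral>x. w x *\<^sub>R f (\<phi> x) \<partial>M)" .
  have "integrable M (\<lambda>x. j x *\<^sub>R f x) \<longleftrightarrow> integrable (density M (\<lambda>x. ennreal (j x))) f"
    using nn by (subst integrable_density) auto
  also have "\<dots> \<longleftrightarrow> integrable (density M (\<lambda>x. ennreal (w x))) (\<lambda>x. f (\<phi> x))"
    unfolding dens by (subst integrable_distr_eq) auto
  also have "\<dots> \<longleftrightarrow> integrable M (\<lambda>x. w x *\<^sub>R f (\<phi> x))"
    using nn by (subst integrable_density) auto
  finally show "integrable M (\<lambda>x. j x *\<^sub>R f x) \<longleftrightarrow> integrable M (\<lambda>x. w x *\<^sub>R f (\<phi> x))" .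
qed

lemma nn_integral_pushforward:
  fixes T F w :: "'a \<Rightarrow> ennreal"
  assumes [measurable]: "\<phi> \<in> measurable M M" "w \<in> borel_measurable M" "F \<in> borel_measurable M"
    and hE: "is_hE M \<phi> w T"
  shows "(\<integral>\<^sup>+x. T x * F x \<partial>M) = (\<integral>\<^sup>+x. w x * F (\<phi> x) \<partial>M)"
proof -
  have [measurable]: "T \<in> borel_measurable M" and dens: "density M T = distr (density M w) M \<phi>"
    using hE by (auto simp: is_hE_density)
  have "(\<integral>\<^sup>+x. T x * F x \<partial>M) = integral\<^sup>N (density M T) F"
    by (subst nn_integral_density) auto
  also have "\<dots> = integral\<^sup>N (density M w) (\<lambda>x. F (\<phi> x))"
    unfolding dens by (subst nn_integral_distr) auto
  also have "\<dots> = (\<integral>\<^sup>+x. w x * F (\<phi> x) \<partial>M)"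
    by (subst nn_integral_density) auto
  finally show ?thesis .
qed

lemma (in sigma_finite_measure) positive_L2_fun_exists:
  obtains q :: "'a \<Rightarrow> real" where "q \<in> borel_measurable M" "\<And>x. x \<in> space M \<Longrightarrow> 0 < q x" "\<And>x. 0 \<le> q x"
    "integrable M (\<lambda>x. (q x)\<^sup>2)"
proof -
  obtain p where p [measurable]: "p \<in> borel_measurable M" and
    pfin: "integral\<^sup>N M p \<noteq> \<infinity>" and ppos: "\<And>x. x \<in> space M \<Longrightarrow> 0 < p x \<and> p x < \<infinity>"
    using Ex_finite_integrable_function by blast
  show ?thesis
  proof (rule that[of "\<lambda>x. sqrt (enn2real (p x))"])
    show "0 < sqrt (enn2real (p x))" if "x \<in> space M" for x
      using ppos[OF that] by (simp add: enn2real_positive_iff)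
    have "(\<integral>\<^sup>+x. ennreal (enn2real (p x)) \<partial>M) = integral\<^sup>N M p"
      using ppos by (intro nn_integral_cong) auto
    then have "integrable M (\<lambda>x. enn2real (p x))"
      using pfin by (intro integrableI_nonneg) (auto simp: less_top[symmetric])
    then show "integrable M (\<lambda>x. (sqrt (enn2real (p x)))\<^sup>2)" by simp
  qed auto
qed

text \<open>A bounded weighted composition operator on classes, \<open>W\<close> in the comments below.\<close>

locale bounded_weighted_comp = sigma_finite_measure M
  for M :: "'a measure" +
  fixes \<phi> :: "'a \<Rightarrow> 'a" and u :: "'a \<Rightarrow> real"
  assumes nonsing: "nonsingular M \<phi>"
    and u_measurable [measurable]: "u \<in> borel_measurable M"
    and u_nonneg: "\<And>x. x \<in> space M \<Longrightarrow> 0 \<le> u x"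
    and bounded: "L2_bounded M (weighted_comp M u \<phi>)"
begin

text \<open>\<open>wc\<close> is \<open>W\<close> on genuine functions, with no choice of representatives.\<close>

definition wc :: "('a \<Rightarrow> complex) \<Rightarrow> 'a \<Rightarrow> complex" where
  "wc f = (\<lambda>x. complex_of_real (u x) * f (\<phi> x))"

text \<open>
  \<open>is_adj k H\<close> says that \<open>H\<close> represents the value of the adjoint \<open>W\<^sup>*\<close> at the class of \<open>k\<close>. As a
  relation it can be used before the existence of the adjoint is known.
\<close>

definition is_adj :: "('a \<Rightarrow> complex) \<Rightarrow> ('a \<Rightarrow> complex) \<Rightarrow> bool" where
  "is_adj k H \<longleftrightarrow> k \<in> L2_fun M \<and> H \<in> L2_fun M \<and>
     (\<forall>f\<in>L2_fun M. (\<integral>x. wc f x * cnj (k x) \<partial>M) = (\<integral>x. f x * cnj (H x) \<partial>M))"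

lemma phi_measurable [measurable]: "\<phi> \<in> measurable M M"
  using nonsing by (simp add: nonsingular_def)

lemma weighted_comp_class:
  "f \<in> L2_fun M \<Longrightarrow> weighted_comp M u \<phi> (L2_class M f) = L2_class M (wc f)"
  by (simp add: weighted_comp_L2_class[OF nonsing] wc_def)

lemma wc_measurable: "f \<in> borel_measurable M \<Longrightarrow> wc f \<in> borel_measurable M"
  by (simp add: wc_def)

lemma wc_diff: "wc f x - wc g x = wc (\<lambda>x. f x - g x) x"
  by (simp add: wc_def right_diff_distrib)

lemma wc_L2:
  assumes "f \<in> L2_fun M"
  shows "wc f \<in> L2_fun M"
proof (rule L2_class_in_L2D)
  show "L2_class M (wc f) \<in> L2 M"
    using bounded L2_class_in_L2[OF assms] weighted_comp_class[OF assms]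
    by (auto simp: L2_bounded_def)
qed (use assms in \<open>auto intro: wc_measurable L2_fun_measurable\<close>)

lemma wc_bounded:
  obtains K where "K > 0"
    "\<And>f. f \<in> L2_fun M \<Longrightarrow> (\<integral>x. (cmod (wc f x))\<^sup>2 \<partial>M) \<le> K * (\<integral>x. (cmod (f x))\<^sup>2 \<partial>M)"
proof -
  obtain C where C: "\<And>F. F \<in> L2 M \<Longrightarrow> L2_norm M (weighted_comp M u \<phi> F) \<le> C * L2_norm M F"
    using bounded by (auto simp: L2_bounded_def)
  show ?thesis
  proof (rule that[of "C\<^sup>2 + 1"])
    show "C\<^sup>2 + 1 > 0" by (simp add: add_nonneg_pos)
    fix f assume f: "f \<in> L2_fun M"
    let ?a = "\<integral>x. (cmod (wc f x))\<^sup>2 \<partial>M" and ?b = "\<integral>x. (cmod (f x))\<^sup>2 \<partial>M"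
    have nn: "?a \<ge> 0" "?b \<ge> 0" by auto
    have "sqrt ?a \<le> C * sqrt ?b"
      using C[OF L2_class_in_L2[OF f]] f
      by (simp add: weighted_comp_class L2_norm_class wc_L2)
    then have "(sqrt ?a)\<^sup>2 \<le> (C * sqrt ?b)\<^sup>2" by (intro power_mono) auto
    then have "?a \<le> C\<^sup>2 * ?b" using nn by (simp add: power_mult_distrib)
    also have "\<dots> \<le> (C\<^sup>2 + 1) * ?b" using nn by (intro mult_right_mono) auto
    finally show "?a \<le> (C\<^sup>2 + 1) * ?b" .
  qed
qed

lemma range_wc_iff:
  assumes g: "g \<in> L2_fun M"
  shows "L2_class M g \<in> weighted_comp M u \<phi> ` L2 M \<longleftrightarrow> (\<exists>f\<in>L2_fun M. AE x in M. g x = wc f x)"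
proof
  assume "L2_class M g \<in> weighted_comp M u \<phi> ` L2 M"
  then obtain f where "f \<in> L2_fun M" "L2_class M g = L2_class M (wc f)"
    by (auto simp: L2_def weighted_comp_class)
  then show "\<exists>f\<in>L2_fun M. AE x in M. g x = wc f x" using L2_class_eqD[OF g] by blast
next
  assume "\<exists>f\<in>L2_fun M. AE x in M. g x = wc f x"
  then obtain f where "f \<in> L2_fun M" "AE x in M. g x = wc f x" by blast
  then have "L2_class M g = weighted_comp M u \<phi> (L2_class M f)" "L2_class M f \<in> L2 M"
    by (simp_all add: weighted_comp_class L2_class_in_L2 L2_class_cong)
  then show "L2_class M g \<in> weighted_comp M u \<phi> ` L2 M" by blast
qed

lemma range_wc_subset: "weighted_comp M u \<phi> ` L2 M \<subseteq> L2 M"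
  using bounded by (auto simp: L2_bounded_def)

section \<open>The adjoint operator\<close>

lemma is_adjD:
  assumes "is_adj k H"
  shows "k \<in> L2_fun M" "H \<in> L2_fun M"
    "f \<in> L2_fun M \<Longrightarrow> (\<integral>x. wc f x * cnj (k x) \<partial>M) = (\<integral>x. f x * cnj (H x) \<partial>M)"
  using assms by (auto simp: is_adj_def)

lemma is_adj_add:
  assumes "is_adj k H" "is_adj k' H'"
  shows "is_adj (\<lambda>x. k x + k' x) (\<lambda>x. H x + H' x)"
  unfolding is_adj_def
proof (intro conjI ballI)
  note L2 = is_adjD[OF assms(1)] is_adjD[OF assms(2)]
  fix f assume f: "f \<in> L2_fun M"
  show "(\<integral>x. wc f x * cnj (k x + k' x) \<partial>M) = (\<integral>x. f x * cnj (H x + H' x) \<partial>M)"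
    using L2(3,6)[OF f] integrable_L2_inner[OF wc_L2[OF f] L2(1)] integrable_L2_inner[OF wc_L2[OF f] L2(4)]
      integrable_L2_inner[OF f L2(2)] integrable_L2_inner[OF f L2(5)]
    by (simp add: distrib_left)
qed (use is_adjD[OF assms(1)] is_adjD[OF assms(2)] in \<open>auto intro: L2_fun_add\<close>)

lemma is_adj_scale:
  assumes "is_adj k H"
  shows "is_adj (\<lambda>x. c * k x) (\<lambda>x. c * H x)"
  unfolding is_adj_def
proof (intro conjI ballI)
  fix f assume f: "f \<in> L2_fun M"
  have "(\<integral>x. wc f x * cnj (c * k x) \<partial>M) = cnj c * (\<integral>x. wc f x * cnj (k x) \<partial>M)"
    by (simp add: mult.left_commute)
  also have "\<dots> = (\<integral>x. f x * cnj (c * H x) \<partial>M)"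
    unfolding is_adjD(3)[OF assms f] by (simp add: mult.left_commute)
  finally show "(\<integral>x. wc f x * cnj (c * k x) \<partial>M) = (\<integral>x. f x * cnj (c * H x) \<partial>M)" .
qed (use is_adjD[OF assms] in \<open>auto intro: L2_fun_scale\<close>)

text \<open>
  For \<open>k \<ge> 0\<close> the adjoint is the Radon-Nikodym density \<open>h E(u k) \<circ> \<phi>\<^sup>-\<^sup>1\<close>, which settles its
  existence without the Riesz representation theorem; the point to be proved is that this
  density is square-integrable.
\<close>

lemma is_adj_exists_nonneg:
  fixes k :: "'a \<Rightarrow> real"
  assumes k [measurable]: "k \<in> borel_measurable M" and k0: "\<And>x. 0 \<le> k x"
    and kL2: "integrable M (\<lambda>x. (k x)\<^sup>2)"
  shows "\<exists>H. is_adj (\<lambda>x. complex_of_real (k x)) H"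
proof -
  obtain K where K: "K > 0"
    "\<And>f. f \<in> L2_fun M \<Longrightarrow> (\<integral>x. (cmod (wc f x))\<^sup>2 \<partial>M) \<le> K * (\<integral>x. (cmod (f x))\<^sup>2 \<partial>M)"
    using wc_bounded by blast
  define w where "w x = u x * k x" for x
  have [measurable]: "w \<in> borel_measurable M" unfolding w_def by measurable
  have w0: "AE x in M. 0 \<le> w x"
    using u_nonneg k0 by (intro AE_I2) (simp add: w_def)
  define T where "T = RN_deriv M (distr (density M (\<lambda>x. ennreal (w x))) M \<phi>)"
  have hE: "is_hE M \<phi> (\<lambda>x. ennreal (w x)) T"
    unfolding T_def by (rule is_hE_exists[OF sigma_finite_measure_axioms nonsing]) measurable
  have T [measurable]: "T \<in> borel_measurable M"
    and dens: "density M T = distr (density M (\<lambda>x. ennreal (w x))) M \<phi>"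
    using hE by (auto simp: is_hE_density)
  \<comment> \<open>The two factors of \<open>k \<cdot> W f\<close> are weighted by \<open>K\<close> and \<open>1/K\<close>, so that the norm of \<open>f\<close> enters
    with the factor \<open>1/2\<close> and can be absorbed below.\<close>
  have pair: "(\<integral>\<^sup>+x. T x * ennreal (f x) \<partial>M) \<le> ennreal ((K * (\<integral>x. (k x)\<^sup>2 \<partial>M) + (\<integral>x. (f x)\<^sup>2 \<partial>M)) / 2)"
    if f [measurable]: "f \<in> borel_measurable M" and f0: "\<And>x. 0 \<le> f x" and fL2: "integrable M (\<lambda>x. (f x)\<^sup>2)" for f
  proof -
    have fc: "(\<lambda>x. complex_of_real (f x)) \<in> L2_fun M" using fL2 by (simp add: L2_fun_def)
    let ?g = "\<lambda>x. (u x * f (\<phi> x))\<^sup>2"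
    have sq: "(cmod (wc (\<lambda>x. complex_of_real (f x)) x))\<^sup>2 = ?g x" for x
      by (simp add: wc_def norm_mult power_mult_distrib)
    have g: "integrable M ?g" "(\<integral>x. ?g x \<partial>M) \<le> K * (\<integral>x. (f x)\<^sup>2 \<partial>M)"
      using L2_fun_integrable[OF wc_L2[OF fc]] K(2)[OF fc] by (simp_all only: sq norm_of_real power2_abs)
    have "(\<integral>\<^sup>+x. T x * ennreal (f x) \<partial>M) = (\<integral>\<^sup>+x. ennreal (w x) * ennreal (f (\<phi> x)) \<partial>M)"
      by (rule nn_integral_pushforward[OF _ _ _ hE]) measurable
    also have "\<dots> \<le> (\<integral>\<^sup>+x. ennreal ((K * (k x)\<^sup>2 + ?g x / K) / 2) \<partial>M)"
    proof (rule nn_integral_mono_AE, use w0 in eventually_elim)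
      case (elim x)
      have "w x * f (\<phi> x) \<le> (K * (k x)\<^sup>2 + ?g x / K) / 2"
      proof -
        have "0 \<le> (K * k x - u x * f (\<phi> x))\<^sup>2 / K" using K by simp
        also have "\<dots> = K * (k x)\<^sup>2 + ?g x / K - 2 * (w x * f (\<phi> x))"
          using K by (simp add: w_def field_simps power2_eq_square)
        finally show ?thesis by simp
      qed
      then show ?case using elim by (simp add: ennreal_mult''[symmetric] f0 ennreal_leI)
    qed
    also have "\<dots> = ennreal (\<integral>x. (K * (k x)\<^sup>2 + ?g x / K) / 2 \<partial>M)"
      using g kL2 K by (intro nn_integral_eq_integral) auto
    also have "\<dots> \<le> ennreal ((K * (\<integral>x. (k x)\<^sup>2 \<partial>M) + (\<integral>x. (f x)\<^sup>2 \<partial>M)) / 2)"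
    proof (rule ennreal_leI)
      have "(\<integral>x. ?g x \<partial>M) / K \<le> (\<integral>x. (f x)\<^sup>2 \<partial>M)"
        using g(2) K(1) by (simp add: field_simps)
      moreover have "(\<integral>x. (K * (k x)\<^sup>2 + ?g x / K) / 2 \<partial>M) =
          (K * (\<integral>x. (k x)\<^sup>2 \<partial>M) + (\<integral>x. ?g x \<partial>M) / K) / 2"
        using g(1) kL2 by simp
      ultimately show "(\<integral>x. (K * (k x)\<^sup>2 + ?g x / K) / 2 \<partial>M) \<le> (K * (\<integral>x. (k x)\<^sup>2 \<partial>M) + (\<integral>x. (f x)\<^sup>2 \<partial>M)) / 2"
        by (simp only: divide_right_mono add_left_mono zero_le_numeral)
    qed
    finally show ?thesis .
  qed
  obtain q :: "'a \<Rightarrow> real" where q: "q \<in> borel_measurable M" "\<And>x. x \<in> space M \<Longrightarrow> 0 < q x" "\<And>x. 0 \<le> q x"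
    "integrable M (\<lambda>x. (q x)\<^sup>2)"
    using positive_L2_fun_exists by blast
  note [measurable] = q(1)
  have "(\<integral>\<^sup>+x. T x * ennreal (q x) \<partial>M) \<noteq> \<infinity>"
    using pair[OF q(1,3,4)] by (auto simp: top_unique)
  then have "AE x in M. T x * ennreal (q x) \<noteq> \<infinity>"
    by (intro nn_integral_PInf_AE) auto
  then have T_fin: "AE x in M. T x \<noteq> \<infinity>"
    using AE_space by eventually_elim (auto simp: ennreal_mult_eq_top_iff ennreal_eq_0_iff dest!: q(2))
  define t where "t x = enn2real (T x)" for x
  have [measurable]: "t \<in> borel_measurable M" unfolding t_def by measurable
  have t0: "0 \<le> t x" for x by (simp add: t_def)
  have tT: "AE x in M. T x = ennreal (t x)"
    using T_fin by eventually_elim (simp add: t_def less_top)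
  then have dens': "density M (\<lambda>x. ennreal (t x)) = distr (density M (\<lambda>x. ennreal (w x))) M \<phi>"
    unfolding dens[symmetric] by (intro density_cong) auto
  \<comment> \<open>Testing against square-integrable truncations of \<open>t\<close> itself bounds its norm.\<close>
  define g where "g n x = min (t x) (real n * q x)" for n x
  have [measurable]: "g n \<in> borel_measurable M" for n unfolding g_def by measurable
  have g0: "0 \<le> g n x" for n x using t0 q(3) by (simp add: g_def)
  have g_int: "integrable M (\<lambda>x. (g n x)\<^sup>2)" for n
  proof (rule Bochner_Integration.integrable_bound[where f = "\<lambda>x. (real n)\<^sup>2 * (q x)\<^sup>2"])
    have "(g n x)\<^sup>2 \<le> (real n * q x)\<^sup>2" for x
      using g0[of n x] by (intro power_mono) (auto simp: g_def)
    then show "AE x in M. norm ((g n x)\<^sup>2) \<le> norm ((real n)\<^sup>2 * (q x)\<^sup>2)"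
      by (intro AE_I2) (simp add: power_mult_distrib)
  qed (use q in auto)
  have g_le: "(\<integral>x. (g n x)\<^sup>2 \<partial>M) \<le> K * (\<integral>x. (k x)\<^sup>2 \<partial>M)" for n
  proof -
    have "ennreal (\<integral>x. (g n x)\<^sup>2 \<partial>M) = (\<integral>\<^sup>+x. ennreal ((g n x)\<^sup>2) \<partial>M)"
      using g_int by (simp add: nn_integral_eq_integral)
    also have "\<dots> \<le> (\<integral>\<^sup>+x. T x * ennreal (g n x) \<partial>M)"
    proof (rule nn_integral_mono_AE, use tT in eventually_elim)
      case (elim x)
      have "(g n x)\<^sup>2 \<le> t x * g n x"
        unfolding power2_eq_square using g0 by (intro mult_right_mono) (auto simp: g_def)
      then show ?case using elim g0 by (simp add: ennreal_mult''[symmetric] ennreal_leI)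
    qed
    also have "\<dots> \<le> ennreal ((K * (\<integral>x. (k x)\<^sup>2 \<partial>M) + (\<integral>x. (g n x)\<^sup>2 \<partial>M)) / 2)"
      using g0 g_int by (intro pair) auto
    finally have "(\<integral>x. (g n x)\<^sup>2 \<partial>M) \<le> (K * (\<integral>x. (k x)\<^sup>2 \<partial>M) + (\<integral>x. (g n x)\<^sup>2 \<partial>M)) / 2"
      using K(1) by (subst (asm) ennreal_le_iff) (auto intro!: add_nonneg_nonneg)
    then show ?thesis by simp
  qed
  have "integrable M (\<lambda>x. (t x)\<^sup>2)"
  proof (rule integrable_of_bounded_truncations[where g = "\<lambda>n x. (g n x)\<^sup>2"])
    show "AE x in M. \<forall>\<^sub>F n in sequentially. (g n x)\<^sup>2 = (t x)\<^sup>2"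
    proof (rule AE_I2)
      fix x assume x: "x \<in> space M"
      obtain N :: nat where N: "t x / q x \<le> real N" using real_arch_simple by blast
      show "\<forall>\<^sub>F n in sequentially. (g n x)\<^sup>2 = (t x)\<^sup>2"
        using eventually_ge_at_top[of N]
      proof eventually_elim
        case (elim n)
        have "t x \<le> real N * q x" using N q(2)[OF x] by (simp add: field_simps)
        also have "\<dots> \<le> real n * q x" using elim q(3) by (intro mult_right_mono) auto
        finally show ?case by (simp add: g_def)
      qed
    qed
  qed (use g_int g_le in auto)
  then have tL2: "(\<lambda>x. complex_of_real (t x)) \<in> L2_fun M" by (simp add: L2_fun_def)
  have "is_adj (\<lambda>x. complex_of_real (k x)) (\<lambda>x. complex_of_real (t x))"
    unfolding is_adj_def
  proof (intro conjI ballI)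
    fix f assume "f \<in> L2_fun M"
    then have [measurable]: "f \<in> borel_measurable M" by (rule L2_fun_measurable)
    have "(\<integral>x. f x * cnj (complex_of_real (t x)) \<partial>M) = (\<integral>x. t x *\<^sub>R f x \<partial>M)"
      by (simp add: scaleR_conv_of_real mult.commute)
    also have "\<dots> = (\<integral>x. w x *\<^sub>R f (\<phi> x) \<partial>M)"
      by (rule integral_pushforward[OF _ _ _ _ w0 _ dens']) (auto simp: t0)
    also have "\<dots> = (\<integral>x. wc f x * cnj (complex_of_real (k x)) \<partial>M)"
      by (simp add: wc_def w_def scaleR_conv_of_real mult_ac)
    finally show "(\<integral>x. wc f x * cnj (complex_of_real (k x)) \<partial>M) = (\<integral>x. f x * cnj (complex_of_real (t x)) \<partial>M)" ..
  qed (use tL2 kL2 in \<open>auto simp: L2_fun_def\<close>)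
  then show ?thesis by blast
qed

lemma is_adj_exists:
  assumes k: "k \<in> L2_fun M"
  shows "\<exists>H. is_adj k H"
proof -
  have [measurable]: "k \<in> borel_measurable M" using k by (rule L2_fun_measurable)
  have ex: "\<exists>H. is_adj (\<lambda>x. complex_of_real (max 0 (r (k x)))) H"
    if [measurable]: "r \<in> borel_measurable borel" and r: "\<And>z. \<bar>r z\<bar> \<le> cmod z" for r :: "complex \<Rightarrow> real"
  proof (rule is_adj_exists_nonneg)
    have "(max 0 (r (k x)))\<^sup>2 \<le> (cmod (k x))\<^sup>2" for x
      using r[of "k x"] by (intro power_mono) auto
    then show "integrable M (\<lambda>x. (max 0 (r (k x)))\<^sup>2)"
      by (intro Bochner_Integration.integrable_bound[OF L2_fun_integrable[OF k]] AE_I2) auto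
  qed auto
  obtain H1 H2 H3 H4 where
    "is_adj (\<lambda>x. complex_of_real (max 0 (Re (k x)))) H1"
    "is_adj (\<lambda>x. complex_of_real (max 0 (- Re (k x)))) H2"
    "is_adj (\<lambda>x. complex_of_real (max 0 (Im (k x)))) H3"
    "is_adj (\<lambda>x. complex_of_real (max 0 (- Im (k x)))) H4"
    using ex[of Re] ex[of "\<lambda>z. - Re z"] ex[of Im] ex[of "\<lambda>z. - Im z"]
    by (auto simp: abs_Re_le_cmod abs_Im_le_cmod)
  then have "is_adj (\<lambda>x. (complex_of_real (max 0 (Re (k x))) + (-1) * complex_of_real (max 0 (- Re (k x)))) +
      \<i> * (complex_of_real (max 0 (Im (k x))) + (-1) * complex_of_real (max 0 (- Im (k x)))))
    (\<lambda>x. (H1 x + (-1) * H2 x) + \<i> * (H3 x + (-1) * H4 x))"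
    by (intro is_adj_add is_adj_scale)
  moreover have "(complex_of_real (max 0 (Re z)) + (-1) * complex_of_real (max 0 (- Re z))) +
      \<i> * (complex_of_real (max 0 (Im z)) + (-1) * complex_of_real (max 0 (- Im z))) = z" for z
    by (rule complex_eqI) auto
  ultimately show ?thesis by auto
qed

lemma is_adj_cong:
  assumes "is_adj k H" "H' \<in> borel_measurable M" "AE x in M. H' x = H x"
  shows "is_adj k H'"
  unfolding is_adj_def
proof (intro conjI ballI)
  note L2 = is_adjD[OF assms(1)]
  show H': "H' \<in> L2_fun M" by (rule L2_fun_cong_AE[OF L2(2) assms(2,3)])
  fix f assume f: "f \<in> L2_fun M"
  note [measurable] = L2_fun_measurable[OF f] L2_fun_measurable[OF L2(2)] assms(2)
  have "(\<integral>x. f x * cnj (H x) \<partial>M) = (\<integral>x. f x * cnj (H' x) \<partial>M)"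
    using assms(3) by (intro integral_cong_AE) auto
  then show "(\<integral>x. wc f x * cnj (k x) \<partial>M) = (\<integral>x. f x * cnj (H' x) \<partial>M)"
    using L2(3)[OF f] by simp
qed (use is_adjD[OF assms(1)] in auto)

lemma L2_adjoint_class:
  assumes "is_adj k H"
  shows "L2_adjoint M (weighted_comp M u \<phi>) (L2_class M k) = L2_class M H"
  unfolding L2_adjoint_def
proof (rule the_equality)
  note L2 = is_adjD[OF assms]
  show "L2_class M H \<in> L2 M \<and> (\<forall>F\<in>L2 M. L2_inner M (weighted_comp M u \<phi> F) (L2_class M k) =
      L2_inner M F (L2_class M H))"
    using L2 unfolding ball_L2 by (simp add: L2_class_in_L2 weighted_comp_class L2_inner_class wc_L2)
  fix G assume G: "G \<in> L2 M \<and> (\<forall>F\<in>L2 M. L2_inner M (weighted_comp M u \<phi> F) (L2_class M k) =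
      L2_inner M F G)"
  then obtain h where h: "h \<in> L2_fun M" "G = L2_class M h" by (auto simp: L2_def)
  have "AE x in M. h x = H x"
  proof (rule L2_fun_eq_AE_of_inner[OF h(1) L2(2)])
    fix f assume f: "f \<in> L2_fun M"
    have "L2_inner M (weighted_comp M u \<phi> (L2_class M f)) (L2_class M k) = L2_inner M (L2_class M f) G"
      using G L2_class_in_L2[OF f] by blast
    then show "(\<integral>x. f x * cnj (h x) \<partial>M) = (\<integral>x. f x * cnj (H x) \<partial>M)"
      using L2 f h by (simp add: weighted_comp_class L2_inner_class wc_L2)
  qed
  then show "G = L2_class M H" unfolding h(2) by (rule L2_class_cong)
qed

lemma range_adjoint_iff:
  assumes h: "h \<in> L2_fun M"
  shows "L2_class M h \<in> L2_adjoint M (weighted_comp M u \<phi>) ` L2 M \<longleftrightarrow> (\<exists>k. is_adj k h)"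
proof
  assume "L2_class M h \<in> L2_adjoint M (weighted_comp M u \<phi>) ` L2 M"
  then obtain k where k: "k \<in> L2_fun M"
    "L2_class M h = L2_adjoint M (weighted_comp M u \<phi>) (L2_class M k)"
    by (auto simp: L2_def)
  obtain H where H: "is_adj k H" using is_adj_exists[OF k(1)] by blast
  then have "L2_class M h = L2_class M H" using k L2_adjoint_class by simp
  then have "AE x in M. h x = H x" by (rule L2_class_eqD[OF h])
  then show "\<exists>k. is_adj k h" using is_adj_cong[OF H L2_fun_measurable[OF h]] by blast
next
  assume "\<exists>k. is_adj k h"
  then obtain k where k: "is_adj k h" by blast
  show "L2_class M h \<in> L2_adjoint M (weighted_comp M u \<phi>) ` L2 M"
    using L2_adjoint_class[OF k] L2_class_in_L2[OF is_adjD(1)[OF k]] by (metis imageI)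
qed

lemma range_adjoint_subset: "L2_adjoint M (weighted_comp M u \<phi>) ` L2 M \<subseteq> L2 M"
proof
  fix G assume "G \<in> L2_adjoint M (weighted_comp M u \<phi>) ` L2 M"
  then obtain k where k: "k \<in> L2_fun M"
    "G = L2_adjoint M (weighted_comp M u \<phi>) (L2_class M k)"
    by (auto simp: L2_def)
  obtain H where H: "is_adj k H" using is_adj_exists[OF k(1)] by blast
  show "G \<in> L2 M" using k L2_adjoint_class[OF H] L2_class_in_L2[OF is_adjD(2)[OF H]] by simp
qed

section \<open>Multiplication by the density\<close>

text \<open>
  Boundedness of \<open>W\<close> enters through a strictly positive square-integrable \<open>q\<close>: as \<open>W q\<close> is square-integrable,
  so is \<open>q\<close> with respect to \<open>J d\<mu>\<close>.
\<close>

lemma hE_square_finite: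
  assumes hE: "is_hE M \<phi> (\<lambda>x. ennreal ((u x)\<^sup>2)) J"
  shows "AE x in M. J x \<noteq> \<infinity>"
proof -
  obtain q :: "'a \<Rightarrow> real" where q: "q \<in> borel_measurable M" "\<And>x. x \<in> space M \<Longrightarrow> 0 < q x" "\<And>x. 0 \<le> q x"
    "integrable M (\<lambda>x. (q x)\<^sup>2)"
    using positive_L2_fun_exists by blast
  note [measurable] = q(1)
  have [measurable]: "J \<in> borel_measurable M" using hE by (simp add: is_hE_def)
  have "(\<lambda>x. complex_of_real (q x)) \<in> L2_fun M" using q by (simp add: L2_fun_def)
  from L2_fun_integrable[OF wc_L2[OF this]]
  have int: "integrable M (\<lambda>x. (u x)\<^sup>2 * (q (\<phi> x))\<^sup>2)"
    by (simp add: wc_def norm_mult power_mult_distrib)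
  have "(\<integral>\<^sup>+x. J x * ennreal ((q x)\<^sup>2) \<partial>M) = (\<integral>\<^sup>+x. ennreal ((u x)\<^sup>2) * ennreal ((q (\<phi> x))\<^sup>2) \<partial>M)"
    by (rule nn_integral_pushforward[OF _ _ _ hE]) measurable
  also have "\<dots> = (\<integral>\<^sup>+x. ennreal ((u x)\<^sup>2 * (q (\<phi> x))\<^sup>2) \<partial>M)"
    by (simp add: ennreal_mult)
  also have "\<dots> = ennreal (\<integral>x. (u x)\<^sup>2 * (q (\<phi> x))\<^sup>2 \<partial>M)"
    using int by (intro nn_integral_eq_integral) auto
  finally have "AE x in M. J x * ennreal ((q x)\<^sup>2) \<noteq> \<infinity>"
    by (intro nn_integral_PInf_AE) auto
  then show ?thesis
    using AE_space by eventually_elim (auto simp: ennreal_mult_eq_top_iff ennreal_eq_0_iff dest!: q(2))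
qed

end

text \<open>
  The function \<open>j\<close> is a real-valued version of \<open>h E(u\<^sup>2) \<circ> \<phi>\<^sup>-\<^sup>1\<close>, characterised by the image measure
  of \<open>u\<^sup>2 d\<mu>\<close> under \<open>\<phi>\<close>. Its support is written \<open>S\<close> in the comments below.
\<close>

locale weighted_comp_density = bounded_weighted_comp +
  fixes j :: "'a \<Rightarrow> real"
  assumes j_measurable [measurable]: "j \<in> borel_measurable M"
    and j_nonneg: "\<And>x. 0 \<le> j x"
    and dens: "density M (\<lambda>x. ennreal (j x)) = distr (density M (\<lambda>x. ennreal ((u x)\<^sup>2))) M \<phi>"
begin

lemma wc_inner_wc:
  assumes [measurable]: "f \<in> borel_measurable M" "g \<in> borel_measurable M"
  shows "(\<integral>x. wc f x * cnj (wc g x) \<partial>M) = (\<integral>x. j x *\<^sub>R (f x * cnj (g x)) \<partial>M)"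
proof -
  have "(\<integral>x. j x *\<^sub>R (f x * cnj (g x)) \<partial>M) = (\<integral>x. (u x)\<^sup>2 *\<^sub>R (f (\<phi> x) * cnj (g (\<phi> x))) \<partial>M)"
    by (rule integral_pushforward[OF _ _ _ _ _ _ dens]) (auto simp: j_nonneg)
  then show ?thesis by (simp add: wc_def scaleR_conv_of_real power2_eq_square mult_ac)
qed

lemma
  assumes [measurable]: "f \<in> borel_measurable M"
  shows wc_norm: "(\<integral>x. (cmod (wc f x))\<^sup>2 \<partial>M) = (\<integral>x. j x * (cmod (f x))\<^sup>2 \<partial>M)"
    and wc_L2_iff: "wc f \<in> L2_fun M \<longleftrightarrow> integrable M (\<lambda>x. j x * (cmod (f x))\<^sup>2)"
proof -
  have eq: "(cmod (wc f x))\<^sup>2 = (u x)\<^sup>2 *\<^sub>R (cmod (f (\<phi> x)))\<^sup>2" for x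
    by (simp add: wc_def norm_mult power_mult_distrib)
  have "(\<integral>x. j x *\<^sub>R (cmod (f x))\<^sup>2 \<partial>M) = (\<integral>x. (u x)\<^sup>2 *\<^sub>R (cmod (f (\<phi> x)))\<^sup>2 \<partial>M)"
    by (rule integral_pushforward[OF _ _ _ _ _ _ dens]) (auto simp: j_nonneg)
  then show "(\<integral>x. (cmod (wc f x))\<^sup>2 \<partial>M) = (\<integral>x. j x * (cmod (f x))\<^sup>2 \<partial>M)"
    by (simp only: eq real_scaleR_def)
  have "integrable M (\<lambda>x. j x *\<^sub>R (cmod (f x))\<^sup>2) \<longleftrightarrow> integrable M (\<lambda>x. (u x)\<^sup>2 *\<^sub>R (cmod (f (\<phi> x)))\<^sup>2)"
    by (rule integrable_pushforward[OF _ _ _ _ _ _ dens]) (auto simp: j_nonneg)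
  moreover have "wc f \<in> borel_measurable M" by (rule wc_measurable) fact
  ultimately show "wc f \<in> L2_fun M \<longleftrightarrow> integrable M (\<lambda>x. j x * (cmod (f x))\<^sup>2)"
    by (simp only: L2_fun_def eq real_scaleR_def mem_Collect_eq simp_thms)
qed

lemma wc_eq_0D:
  assumes f: "f \<in> borel_measurable M" "wc f \<in> L2_fun M" and eq: "AE x in M. wc f x = 0"
  shows "AE x in M. j x = 0 \<or> f x = 0"
proof -
  have "(\<integral>x. (cmod (wc f x))\<^sup>2 \<partial>M) = 0"
    using eq by (intro integral_eq_zero_AE) auto
  then have "(\<integral>x. j x * (cmod (f x))\<^sup>2 \<partial>M) = 0" by (simp add: wc_norm f)
  then have "AE x in M. j x * (cmod (f x))\<^sup>2 = 0"
    using f by (subst (asm) integral_nonneg_eq_0_iff_AE) (auto simp: wc_L2_iff j_nonneg)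
  then show ?thesis by eventually_elim simp
qed

text \<open>\<open>W\<^sup>*W\<close> is multiplication by \<open>j\<close>.\<close>

lemma is_adj_wc:
  assumes f: "f \<in> L2_fun M" and h: "h \<in> L2_fun M" and eq: "AE x in M. h x = complex_of_real (j x) * f x"
  shows "is_adj (wc f) h"
  unfolding is_adj_def
proof (intro conjI ballI)
  fix g assume g: "g \<in> L2_fun M"
  note [measurable] = L2_fun_measurable[OF f] L2_fun_measurable[OF h] L2_fun_measurable[OF g]
  have "(\<integral>x. wc g x * cnj (wc f x) \<partial>M) = (\<integral>x. j x *\<^sub>R (g x * cnj (f x)) \<partial>M)"
    by (rule wc_inner_wc) measurable
  also have "\<dots> = (\<integral>x. g x * cnj (h x) \<partial>M)"
    using eq by (intro integral_cong_AE) (auto simp: scaleR_conv_of_real mult_ac elim: eventually_mono)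
  finally show "(\<integral>x. wc g x * cnj (wc f x) \<partial>M) = (\<integral>x. g x * cnj (h x) \<partial>M)" .
qed (use f h wc_L2 in auto)

text \<open>The range of \<open>W\<^sup>*\<close> is orthogonal to the functions vanishing on \<open>S\<close>, which \<open>W\<close> annihilates.\<close>

lemma is_adj_vanishes:
  assumes "is_adj k H"
  shows "AE x in M. j x = 0 \<longrightarrow> H x = 0"
proof -
  note L2 = is_adjD[OF assms]
  note [measurable] = L2_fun_measurable[OF L2(2)]
  define f where "f x = indicator {x. j x = 0} x * H x" for x
  have [measurable]: "f \<in> borel_measurable M" unfolding f_def by measurable
  have f: "f \<in> L2_fun M"
    by (rule L2_fun_bound[OF _ L2_fun_integrable[OF L2(2)]]) (auto simp: f_def indicator_def)
  have "j x * (cmod (f x))\<^sup>2 = 0" for x by (simp add: f_def indicator_def)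
  then have "(\<integral>x. (cmod (wc f x))\<^sup>2 \<partial>M) = 0"
    by (simp only: wc_norm[OF L2_fun_measurable[OF f]] integral_zero)
  then have wc0: "AE x in M. wc f x = 0" by (intro L2_fun_eq_0_AE wc_L2 f) simp
  have "complex_of_real (\<integral>x. (cmod (f x))\<^sup>2 \<partial>M) = (\<integral>x. f x * cnj (f x) \<partial>M)"
    by (simp only: integral_complex_of_real[symmetric] complex_norm_square)
  also have "\<dots> = (\<integral>x. f x * cnj (H x) \<partial>M)"
    by (intro Bochner_Integration.integral_cong) (auto simp: f_def indicator_def)
  also have "\<dots> = (\<integral>x. wc f x * cnj (k x) \<partial>M)" using L2(3)[OF f] by simp
  also have "\<dots> = 0"
    using wc0 by (intro integral_eq_zero_AE) (auto elim: eventually_mono)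
  finally have "AE x in M. f x = 0" by (intro L2_fun_eq_0_AE[OF f]) simp
  then show ?thesis by eventually_elim (auto simp: f_def)
qed

section \<open>Closedness of the ranges\<close>

text \<open>
  Put \<open>f = sqrt (H / j)\<close>. Since \<open>j f\<^sup>2 = H\<close> is integrable, \<open>W f\<close> makes sense as a limit of
  images of the truncations of \<open>f\<close> to \<open>{j \<ge> 1/n}\<close>, although \<open>f\<close> itself need not be square-integrable.
  If the range is closed, then \<open>W f = W f'\<close> with \<open>f'\<close> square-integrable, and \<open>f = f'\<close> on \<open>S\<close>.
\<close>

lemma closed_range_imp_integrable:
  assumes cl: "L2_closed_range M (weighted_comp M u \<phi>)"
    and H: "integrable M H" "\<And>x. 0 \<le> H x" "\<And>x. j x = 0 \<Longrightarrow> H x = 0"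
  shows "integrable M (\<lambda>x. H x / j x)"
proof -
  have [measurable]: "H \<in> borel_measurable M" using H by auto
  define f where "f x = complex_of_real (sqrt (H x / j x))" for x
  have [measurable]: "f \<in> borel_measurable M" unfolding f_def by measurable
  have cmod_f: "(cmod (f x))\<^sup>2 = H x / j x" for x
    using H(2)[of x] j_nonneg[of x] by (simp add: f_def)
  have jf: "j x * (cmod (f x))\<^sup>2 = H x" for x
    using H(3)[of x] by (simp add: cmod_f)
  have wcf: "wc f \<in> L2_fun M" using H(1) by (simp add: wc_L2_iff jf)
  have "L2_class M (wc f) \<in> weighted_comp M u \<phi> ` L2 M"
  proof (rule cl[unfolded L2_closed_range_def L2_closed_iff[OF range_wc_subset], rule_format, OF wcf])
    fix \<epsilon> :: real assume "\<epsilon> > 0"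
    then have "\<forall>\<^sub>F n in sequentially. (\<integral>x. indicator {x. j x < 1 / real (Suc n)} x * H x \<partial>M) < \<epsilon>"
      by (intro order_tendstoD(2)[OF integral_truncation_tendsto_0] H j_nonneg) auto
    then obtain n where n: "(\<integral>x. indicator {x. j x < 1 / real (Suc n)} x * H x \<partial>M) < \<epsilon>"
      by (auto simp: eventually_sequentially)
    define fn where "fn x = indicator {x. 1 / real (Suc n) \<le> j x} x * f x" for x
    have [measurable]: "fn \<in> borel_measurable M" unfolding fn_def by measurable
    have fn: "fn \<in> L2_fun M"
    proof (rule L2_fun_bound)
      have "(cmod (fn x))\<^sup>2 \<le> real (Suc n) * H x" for x
      proof (cases "1 / real (Suc n) \<le> j x")
        case True
        moreover have "0 < 1 / real (Suc n)" by simp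
        ultimately have "0 < j x" "1 \<le> real (Suc n) * j x" by (linarith, simp add: field_simps)
        then have "H x * 1 \<le> H x * (real (Suc n) * j x)" using H(2) by (intro mult_left_mono)
        then have "H x / j x \<le> real (Suc n) * H x" using \<open>0 < j x\<close> by (simp add: field_simps)
        then show ?thesis using True by (simp add: fn_def cmod_f)
      qed (simp add: fn_def H(2))
      then show "AE x in M. (cmod (fn x))\<^sup>2 \<le> real (Suc n) * H x" by simp
    qed (use H in auto)
    have "(\<integral>x. (cmod (wc fn x - wc f x))\<^sup>2 \<partial>M) = (\<integral>x. j x * (cmod (fn x - f x))\<^sup>2 \<partial>M)"
      unfolding wc_diff by (rule wc_norm) measurable
    also have "\<dots> = (\<integral>x. indicator {x. j x < 1 / real (Suc n)} x * H x \<partial>M)"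
      by (intro Bochner_Integration.integral_cong) (auto simp: fn_def indicator_def jf)
    finally show "\<exists>g\<in>L2_fun M. L2_class M g \<in> weighted_comp M u \<phi> ` L2 M \<and>
        (\<integral>x. (cmod (g x - wc f x))\<^sup>2 \<partial>M) < \<epsilon>"
      using n fn range_wc_iff[OF wc_L2[OF fn]] wc_L2[OF fn] by (intro bexI[of _ "wc fn"]) auto
  qed
  then obtain f' where f': "f' \<in> L2_fun M" "AE x in M. wc f x = wc f' x"
    using range_wc_iff[OF wcf] by blast
  note [measurable] = L2_fun_measurable[OF f'(1)]
  have "AE x in M. j x = 0 \<or> f x - f' x = 0"
  proof (rule wc_eq_0D)
    show "wc (\<lambda>x. f x - f' x) \<in> L2_fun M"
      using L2_fun_diff[OF wcf wc_L2[OF f'(1)]] by (simp add: wc_diff)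
    show "AE x in M. wc (\<lambda>x. f x - f' x) x = 0"
      using f'(2) by eventually_elim (simp flip: wc_diff)
  qed measurable
  then have "AE x in M. norm (H x / j x) \<le> norm ((cmod (f' x))\<^sup>2)"
  proof eventually_elim
    case (elim x)
    then show ?case using cmod_f[of x] by (cases "j x = 0") auto
  qed
  then show ?thesis
    by (intro Bochner_Integration.integrable_bound[OF L2_fun_integrable[OF f'(1)]]) auto
qed

text \<open>
  The truncations of \<open>h = sqrt H\<close> to \<open>{j \<ge> 1/n}\<close> are the values of \<open>W\<^sup>*W\<close> at \<open>f\<^sub>n = h / j\<close> (cut off in the
  same way), so a closed range of \<open>W\<^sup>*\<close> contains \<open>h\<close>, say \<open>h = W\<^sup>* k\<close>. Then
  \<open>\<parallel>W f\<^sub>n\<parallel>\<^sup>2 = \<langle>f\<^sub>n, h\<rangle> = \<langle>W f\<^sub>n, k\<rangle>\<close> is the integral of \<open>H / j\<close> over \<open>{j \<ge> 1/n}\<close>, and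
  it is at most \<open>\<parallel>k\<parallel>\<^sup>2\<close>.
\<close>

lemma adjoint_closed_range_imp_integrable:
  assumes cl: "L2_closed_range M (L2_adjoint M (weighted_comp M u \<phi>))"
    and H: "integrable M H" "\<And>x. 0 \<le> H x" "\<And>x. j x = 0 \<Longrightarrow> H x = 0"
  shows "integrable M (\<lambda>x. H x / j x)"
proof -
  have [measurable]: "H \<in> borel_measurable M" using H by auto
  define h where "h x = complex_of_real (sqrt (H x))" for x
  have [measurable]: "h \<in> borel_measurable M" unfolding h_def by measurable
  have cmod_h: "(cmod (h x))\<^sup>2 = H x" for x using H(2)[of x] by (simp add: h_def)
  have h: "h \<in> L2_fun M" using H by (simp add: L2_fun_def cmod_h)
  define I where "I n x = (if 1 / real (Suc n) \<le> j x then 1 else 0 :: real)" for n x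
  have [measurable]: "I n \<in> borel_measurable M" for n unfolding I_def by measurable
  have I_pos: "0 < j x" "1 \<le> real (Suc n) * j x" if "I n x \<noteq> 0" for n x
  proof -
    have "1 / real (Suc n) \<le> j x" using that by (auto simp: I_def split: if_splits)
    moreover have "0 < 1 / real (Suc n)" by simp
    ultimately show "0 < j x" "1 \<le> real (Suc n) * j x" by (linarith, simp add: field_simps)
  qed
  have I_cases: "I n x = 0 \<or> I n x = 1" for n x by (simp add: I_def)
  define f where "f n x = complex_of_real (I n x / j x) * h x" for n x
  have [measurable]: "f n \<in> borel_measurable M" for n unfolding f_def by measurable
  have cmod_f: "(cmod (f n x))\<^sup>2 = I n x * H x / (j x)\<^sup>2" for n x
    using I_cases[of n x] by (auto simp: f_def norm_mult norm_divide power_mult_distrib power_divide cmod_h)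
  have f: "f n \<in> L2_fun M" for n
  proof (rule L2_fun_bound)
    have "(cmod (f n x))\<^sup>2 \<le> (real (Suc n))\<^sup>2 * H x" for x
    proof (cases "I n x = 0")
      case False
      note pos = I_pos[OF this]
      have "1\<^sup>2 \<le> (real (Suc n) * j x)\<^sup>2" using pos by (intro power_mono) auto
      then have "H x * 1 \<le> H x * (real (Suc n) * j x)\<^sup>2" using H(2) by (intro mult_left_mono) auto
      then show ?thesis
        using pos False I_cases[of n x] by (simp add: cmod_f power_mult_distrib field_simps del: of_nat_Suc)
    qed (simp add: cmod_f H(2))
    then show "AE x in M. (cmod (f n x))\<^sup>2 \<le> (real (Suc n))\<^sup>2 * H x" by simp
  qed (use H in auto)
  define hn where "hn n x = complex_of_real (I n x) * h x" for n x
  have [measurable]: "hn n \<in> borel_measurable M" for n unfolding hn_def by measurable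
  have hn: "hn n \<in> L2_fun M" for n
    by (intro L2_fun_bound[OF _ L2_fun_integrable[OF h]] AE_I2) (auto simp: hn_def I_def norm_mult)
  have adj: "is_adj (wc (f n)) (hn n)" for n
  proof (rule is_adj_wc[OF f hn AE_I2])
    show "hn n x = complex_of_real (j x) * f n x" for x
      using I_pos(1)[of n x] by (cases "I n x = 0") (auto simp: hn_def f_def)
  qed
  have "L2_class M h \<in> L2_adjoint M (weighted_comp M u \<phi>) ` L2 M"
  proof (rule cl[unfolded L2_closed_range_def L2_closed_iff[OF range_adjoint_subset], rule_format, OF h])
    fix \<epsilon> :: real assume "\<epsilon> > 0"
    then have "\<forall>\<^sub>F n in sequentially. (\<integral>x. indicator {x. j x < 1 / real (Suc n)} x * H x \<partial>M) < \<epsilon>"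
      by (intro order_tendstoD(2)[OF integral_truncation_tendsto_0] H j_nonneg) auto
    then obtain n where n: "(\<integral>x. indicator {x. j x < 1 / real (Suc n)} x * H x \<partial>M) < \<epsilon>"
      by (auto simp: eventually_sequentially)
    have "(\<integral>x. (cmod (hn n x - h x))\<^sup>2 \<partial>M) = (\<integral>x. indicator {x. j x < 1 / real (Suc n)} x * H x \<partial>M)"
      by (intro Bochner_Integration.integral_cong) (auto simp: hn_def I_def indicator_def cmod_h)
    then show "\<exists>g\<in>L2_fun M. L2_class M g \<in> L2_adjoint M (weighted_comp M u \<phi>) ` L2 M \<and>
        (\<integral>x. (cmod (g x - h x))\<^sup>2 \<partial>M) < \<epsilon>"
      using n hn[of n] adj[of n] range_adjoint_iff[OF hn[of n]] by (intro bexI[of _ "hn n"]) auto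
  qed
  then obtain k where k: "is_adj k h" using range_adjoint_iff[OF h] by blast
  show ?thesis
  proof (rule integrable_of_bounded_truncations)
    fix n
    have eq1: "I n x * (H x / j x) = j x * (cmod (f n x))\<^sup>2" for x
      unfolding cmod_f by (simp add: power2_eq_square)
    show int: "integrable M (\<lambda>x. I n x * (H x / j x))"
      unfolding eq1 using wc_L2[OF f[of n]] by (simp add: wc_L2_iff)
    have eq2: "f n x * cnj (h x) = complex_of_real (I n x * (H x / j x))" for x
      by (simp add: f_def mult.assoc complex_norm_square[symmetric] cmod_h)
    have "(\<integral>x. wc (f n) x * cnj (k x) \<partial>M) = complex_of_real (\<integral>x. I n x * (H x / j x) \<partial>M)"
      unfolding is_adjD(3)[OF k f] eq2 by (rule integral_complex_of_real)
    moreover have "(\<integral>x. (cmod (wc (f n) x))\<^sup>2 \<partial>M) = (\<integral>x. I n x * (H x / j x) \<partial>M)"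
      unfolding eq1 by (simp add: wc_norm)
    ultimately show "(\<integral>x. I n x * (H x / j x) \<partial>M) \<le> (\<integral>x. (cmod (k x))\<^sup>2 \<partial>M)"
      using L2_inner_AM_GM[OF wc_L2[OF f[of n]] is_adjD(1)[OF k]] by simp
    show "AE x in M. 0 \<le> I n x * (H x / j x)" by (intro AE_I2) (simp add: I_def H(2) j_nonneg)
  next
    show "AE x in M. \<forall>\<^sub>F n in sequentially. I n x * (H x / j x) = H x / j x"
    proof (rule AE_I2)
      fix x
      show "\<forall>\<^sub>F n in sequentially. I n x * (H x / j x) = H x / j x"
      proof (cases "j x = 0")
        case False
        with j_nonneg[of x] have "j x > 0" by simp
        moreover have "(\<lambda>n. 1 / real (Suc n)) \<longlonglongrightarrow> 0" by real_asymp
        ultimately have "\<forall>\<^sub>F n in sequentially. 1 / real (Suc n) < j x"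
          by (rule order_tendstoD(2)[rotated])
        then show ?thesis by eventually_elim (simp add: I_def)
      qed simp
    qed
  qed (use H j_nonneg in auto)
qed

context
  fixes \<delta> :: real
  assumes \<delta>: "\<delta> > 0" "AE x in M. j x \<noteq> 0 \<longrightarrow> \<delta> \<le> j x"
begin

lemma divide_L2:
  assumes H: "H \<in> L2_fun M"
  shows "(\<lambda>x. H x / complex_of_real (j x)) \<in> L2_fun M"
proof (rule L2_fun_bound)
  note [measurable] = L2_fun_measurable[OF H]
  show "(\<lambda>x. H x / complex_of_real (j x)) \<in> borel_measurable M" by measurable
  show "integrable M (\<lambda>x. (cmod (H x))\<^sup>2 / \<delta>\<^sup>2)" using L2_fun_integrable[OF H] by simp
  show "AE x in M. (cmod (H x / complex_of_real (j x)))\<^sup>2 \<le> (cmod (H x))\<^sup>2 / \<delta>\<^sup>2"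
    using \<delta>(2)
  proof eventually_elim
    case (elim x)
    show ?case
    proof (cases "j x = 0")
      case False
      then show ?thesis using elim \<delta>(1)
        by (simp add: norm_divide power_divide) (intro divide_left_mono power_mono mult_pos_pos zero_less_power, auto)
    qed simp
  qed
qed

lemma is_adj_wc_divide:
  assumes H: "H \<in> L2_fun M" and v: "AE x in M. j x = 0 \<longrightarrow> H x = 0"
  shows "is_adj (wc (\<lambda>x. H x / complex_of_real (j x))) H"
  by (rule is_adj_wc[OF divide_L2[OF H] H]) (use v in \<open>auto elim: eventually_mono\<close>)

text \<open>
  For \<open>g\<close> in the closure of the range put \<open>q = (W\<^sup>* g) / j\<close>. Then \<open>W\<^sup>*W q = W\<^sup>* g\<close>, so \<open>g - W q\<close> is
  orthogonal to the range; being also in its closure, it vanishes. Completeness of the space is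
  not used.
\<close>

lemma closed_range_wc: "L2_closed_range M (weighted_comp M u \<phi>)"
  unfolding L2_closed_range_def L2_closed_iff[OF range_wc_subset]
proof (intro ballI impI)
  fix g assume g: "g \<in> L2_fun M"
  assume near: "\<forall>\<epsilon>>0. \<exists>f\<in>L2_fun M. L2_class M f \<in> weighted_comp M u \<phi> ` L2 M \<and>
    (\<integral>x. (cmod (f x - g x))\<^sup>2 \<partial>M) < \<epsilon>"
  obtain H where H: "is_adj g H" using is_adj_exists[OF g] by blast
  define q where "q x = H x / complex_of_real (j x)" for x
  have q: "q \<in> L2_fun M" unfolding q_def by (rule divide_L2[OF is_adjD(2)[OF H]])
  have adjq: "is_adj (wc q) H"
    unfolding q_def by (rule is_adj_wc_divide[OF is_adjD(2)[OF H] is_adj_vanishes[OF H]])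
  define e where "e x = g x - wc q x" for x
  have e: "e \<in> L2_fun M" unfolding e_def by (rule L2_fun_diff[OF g wc_L2[OF q]])
  have orth: "(\<integral>x. wc f x * cnj (e x) \<partial>M) = 0" if f: "f \<in> L2_fun M" for f
    using is_adjD(3)[OF H f] is_adjD(3)[OF adjq f] integrable_L2_inner[OF wc_L2[OF f] g]
      integrable_L2_inner[OF wc_L2[OF f] wc_L2[OF q]]
    by (simp add: e_def right_diff_distrib)
  have "(\<integral>x. (cmod (e x))\<^sup>2 \<partial>M) \<le> 0"
  proof (rule field_le_epsilon)
    fix \<epsilon> :: real assume "\<epsilon> > 0"
    then obtain a where a: "a \<in> L2_fun M" "L2_class M a \<in> weighted_comp M u \<phi> ` L2 M"
      "(\<integral>x. (cmod (a x - g x))\<^sup>2 \<partial>M) < \<epsilon>" using near by blast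
    then obtain f where f: "f \<in> L2_fun M" "AE x in M. a x = wc f x"
      using range_wc_iff by blast
    note fq = L2_fun_diff[OF f(1) q] and ga = L2_fun_diff[OF g a(1)]
    note [measurable] = L2_fun_measurable[OF e] L2_fun_measurable[OF ga] L2_fun_measurable[OF wc_L2[OF fq]]
    have "complex_of_real (\<integral>x. (cmod (e x))\<^sup>2 \<partial>M) = (\<integral>x. e x * cnj (e x) \<partial>M)"
      by (simp only: integral_complex_of_real[symmetric] complex_norm_square)
    also have "\<dots> = (\<integral>x. (g x - a x) * cnj (e x) + wc (\<lambda>x. f x - q x) x * cnj (e x) \<partial>M)"
    proof (rule integral_cong_AE)
      show "AE x in M. e x * cnj (e x) = (g x - a x) * cnj (e x) + wc (\<lambda>x. f x - q x) x * cnj (e x)"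
        using f(2) by eventually_elim (simp add: e_def wc_diff[symmetric] distrib_right[symmetric])
    qed measurable
    also have "\<dots> = (\<integral>x. (g x - a x) * cnj (e x) \<partial>M)"
      using integrable_L2_inner[OF ga e] integrable_L2_inner[OF wc_L2[OF fq] e] orth[OF fq]
      by (subst Bochner_Integration.integral_add) auto
    finally have "Re (\<integral>x. (g x - a x) * cnj (e x) \<partial>M) = (\<integral>x. (cmod (e x))\<^sup>2 \<partial>M)"
      by (metis Re_complex_of_real)
    then have "(\<integral>x. (cmod (e x))\<^sup>2 \<partial>M) \<le> (\<integral>x. (cmod (g x - a x))\<^sup>2 \<partial>M)"
      using L2_inner_AM_GM[OF ga e] by simp
    then show "(\<integral>x. (cmod (e x))\<^sup>2 \<partial>M) \<le> 0 + \<epsilon>"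
      using a(3) by (simp add: norm_minus_commute)
  qed
  then have "AE x in M. g x = wc q x"
    using L2_fun_eq_0_AE[OF e] by (auto simp: e_def)
  then show "L2_class M g \<in> weighted_comp M u \<phi> ` L2 M"
    using q range_wc_iff[OF g] by blast
qed

text \<open>Here the range of \<open>W\<^sup>*\<close> consists of all square-integrable functions vanishing off \<open>S\<close>.\<close>

lemma closed_range_adjoint: "L2_closed_range M (L2_adjoint M (weighted_comp M u \<phi>))"
  unfolding L2_closed_range_def L2_closed_iff[OF range_adjoint_subset]
proof (intro ballI impI)
  fix g assume g: "g \<in> L2_fun M"
  assume near: "\<forall>\<epsilon>>0. \<exists>f\<in>L2_fun M. L2_class M f \<in> L2_adjoint M (weighted_comp M u \<phi>) ` L2 M \<and>
    (\<integral>x. (cmod (f x - g x))\<^sup>2 \<partial>M) < \<epsilon>"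
  note [measurable] = L2_fun_measurable[OF g]
  define g0 where "g0 x = indicator {x. j x = 0} x * g x" for x
  have [measurable]: "g0 \<in> borel_measurable M" unfolding g0_def by measurable
  have g0: "g0 \<in> L2_fun M"
    by (rule L2_fun_bound[OF _ L2_fun_integrable[OF g]]) (auto simp: g0_def indicator_def)
  have "(\<integral>x. (cmod (g0 x))\<^sup>2 \<partial>M) \<le> 0"
  proof (rule field_le_epsilon)
    fix \<epsilon> :: real assume "\<epsilon> > 0"
    then obtain f where f: "f \<in> L2_fun M"
      "L2_class M f \<in> L2_adjoint M (weighted_comp M u \<phi>) ` L2 M"
      "(\<integral>x. (cmod (f x - g x))\<^sup>2 \<partial>M) < \<epsilon>" using near by blast
    then obtain k where "is_adj k f" using range_adjoint_iff by blast
    then have "AE x in M. j x = 0 \<longrightarrow> f x = 0" by (rule is_adj_vanishes)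
    then have "AE x in M. (cmod (g0 x))\<^sup>2 \<le> (cmod (f x - g x))\<^sup>2"
      by eventually_elim (auto simp: g0_def indicator_def)
    then have "(\<integral>x. (cmod (g0 x))\<^sup>2 \<partial>M) \<le> (\<integral>x. (cmod (f x - g x))\<^sup>2 \<partial>M)"
      by (intro integral_mono_AE L2_fun_integrable L2_fun_diff g0 f(1) g)
    then show "(\<integral>x. (cmod (g0 x))\<^sup>2 \<partial>M) \<le> 0 + \<epsilon>" using f(3) by simp
  qed
  then have "AE x in M. g0 x = 0" by (rule L2_fun_eq_0_AE[OF g0])
  then have "AE x in M. j x = 0 \<longrightarrow> g x = 0" by eventually_elim (auto simp: g0_def)
  then show "L2_class M g \<in> L2_adjoint M (weighted_comp M u \<phi>) ` L2 M"
    using is_adj_wc_divide[OF g] range_adjoint_iff[OF g] by blast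
qed

end

lemma closed_range_iff:
  "L2_closed_range M (weighted_comp M u \<phi>) \<longleftrightarrow> (\<exists>\<delta>>0. AE x in M. j x \<noteq> 0 \<longrightarrow> \<delta> \<le> j x)"
  using bounded_below_on_support[OF j_measurable j_nonneg] closed_range_imp_integrable closed_range_wc
  by blast

lemma adjoint_closed_range_iff:
  "L2_closed_range M (L2_adjoint M (weighted_comp M u \<phi>)) \<longleftrightarrow>
    (\<exists>\<delta>>0. AE x in M. j x \<noteq> 0 \<longrightarrow> \<delta> \<le> j x)"
  using bounded_below_on_support[OF j_measurable j_nonneg] adjoint_closed_range_imp_integrable
    closed_range_adjoint
  by blast

end

theorem proposition3p2:
  fixes M :: "'a measure" and \<phi> :: "'a \<Rightarrow> 'a" and u :: "'a \<Rightarrow> real" and J :: "'a \<Rightarrow> ennreal"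
  assumes "sigma_finite_measure M"
    and "nonsingular M \<phi>"
    and "u \<in> borel_measurable M"
    and "\<And>x. x \<in> space M \<Longrightarrow> 0 \<le> u x"
    and "L2_bounded M (weighted_comp M u \<phi>)"
    and "is_hE M \<phi> (\<lambda>x. ennreal (\<bar>u x\<bar>\<^sup>2)) J"
  shows "(L2_closed_range M (weighted_comp M u \<phi>) \<longleftrightarrow>
            L2_closed_range M (L2_adjoint M (weighted_comp M u \<phi>))) \<and>
         (L2_closed_range M (weighted_comp M u \<phi>) \<longleftrightarrow>
            (\<exists>\<delta>::real. \<delta> > 0 \<and> (AE x in M. x \<in> support_on (space M) J \<longrightarrow> ennreal \<delta> \<le> J x)))"
proof -
  interpret sigma_finite_measure M by fact
  interpret bounded_weighted_comp M \<phi> u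
    using assms by unfold_locales auto
  have hE: "is_hE M \<phi> (\<lambda>x. ennreal ((u x)\<^sup>2)) J" using assms(6) by simp
  have [measurable]: "J \<in> borel_measurable M" using hE by (simp add: is_hE_def)
  define j where "j x = enn2real (J x)" for x
  have [measurable]: "j \<in> borel_measurable M" unfolding j_def by measurable
  have jJ: "AE x in M. J x = ennreal (j x)"
    using hE_square_finite[OF hE] by eventually_elim (simp add: j_def less_top)
  interpret weighted_comp_density M \<phi> u j
  proof
    show "j \<in> borel_measurable M" by measurable
    show "0 \<le> j x" for x by (simp add: j_def)
    have "density M (\<lambda>x. ennreal (j x)) = density M J"
      using jJ by (intro density_cong) (auto elim: eventually_mono)
    then show "density M (\<lambda>x. ennreal (j x)) = distr (density M (\<lambda>x. ennreal ((u x)\<^sup>2))) M \<phi>"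
      using hE by (simp add: is_hE_density)
  qed
  have "(AE x in M. x \<in> support_on (space M) J \<longrightarrow> ennreal \<delta> \<le> J x) \<longleftrightarrow>
      (AE x in M. j x \<noteq> 0 \<longrightarrow> \<delta> \<le> j x)" for \<delta>
  proof -
    have "AE x in M. (x \<in> support_on (space M) J \<longrightarrow> ennreal \<delta> \<le> J x) \<longleftrightarrow> (j x \<noteq> 0 \<longrightarrow> \<delta> \<le> j x)"
      using jJ AE_space
    proof eventually_elim
      case (elim x)
      have "0 \<le> j x" by (rule j_nonneg)
      then show ?case using elim by (auto simp: support_on_def ennreal_eq_0_iff)
    qed
    then show ?thesis by (rule eventually_subst)
  qed
  then show ?thesis
    using closed_range_iff adjoint_closed_range_iff by simp
qed

end
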